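(* Let $G$ be a countably infinite bounded Abelian group. Then $G$ admits a Hausdorff minimally almost periodic group topology if and only if all leading Ulm-Kaplansky invariants of $G$ are infinite. In such a case, a Hausdorff minimally almost periodic group topology on $G$ can be chosen to be complete.
   Context: $G$ is bounded if $\exp G<\infty$, where $\exp G$ is the least common multiple of the orders of the elements of $G$. A bounded Abelian group $G$ has the form $G=\bigoplus_{p\in M}\bigoplus_{i=1}^{n_p}\mathbb{Z}(p^i)^{(k_{i,p})}$, where $M$ is a finite set of primes, the $k_{i,p}$ are cardinals, and $k_{n_p,p}\neq 0$ for each $p\in M$ (so $p^{n_p}$ is the exponent of the $p$-component). The leading Ulm-Kaplansky invariants of $G$ are the cardinals $k_{n_p,p}$, $p\in M$. A topological Abelian group $X$ (or its topology) is minimally almost periodic (MinAP) if its von Neumann radical $\mathbf{n}(X)=\bigcap_{\chi\in X^\wedge}\ker\chi$ equals $X$, where $X^\wedge$ is the group of continuous characters (continuous homomorphisms to the circle group). *)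

theory Defs
  imports "HOL-Analysis.Analysis" "HOL-Algebra.Multiplicative_Group" "HOL-Algebra.Product_Groups"
begin

definition group_exponent :: "('a, 'm) monoid_scheme \<Rightarrow> nat" where
  "group_exponent G = Lcm (group.ord G ` carrier G)"

text \<open>The value 0 stands for an infinite exponent: elements of infinite order have order 0 in
  the library, and on natural numbers a set that contains 0 or is infinite has least common
  multiple 0.\<close>

definition bounded_group :: "('a, 'm) monoid_scheme \<Rightarrow> bool" where
  "bounded_group G \<longleftrightarrow> group_exponent G \<noteq> 0"

text \<open>The cardinals \<open>k\<^sub>i\<^sub>,\<^sub>p\<close> are represented by index sets \<open>k i p\<close>, so that the direct sum of
  \<open>k\<^sub>i\<^sub>,\<^sub>p\<close> copies of the cyclic group of order \<open>p^i\<close> is indexed by \<open>k i p\<close>. Taking these sets in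
  the type of the group elements is no restriction, since \<open>k\<^sub>i\<^sub>,\<^sub>p\<close> is at most the cardinality
  of the group.\<close>

definition cyclic_decomposition ::
    "('a, 'm) monoid_scheme \<Rightarrow> nat set \<Rightarrow> (nat \<Rightarrow> nat) \<Rightarrow> (nat \<Rightarrow> nat \<Rightarrow> 'a set) \<Rightarrow> bool" where
  "cyclic_decomposition G M n k \<longleftrightarrow>
     finite M \<and>
     (\<forall>p\<in>M. Factorial_Ring.prime p \<and> 1 \<le> n p \<and> k (n p) p \<noteq> {}) \<and>
     G \<cong> sum_group {(p, i, j). p \<in> M \<and> i \<in> {1..n p} \<and> j \<in> k i p}
                   (\<lambda>(p, i, j). integer_mod_group (p ^ i))"

text \<open>\<open>leading_UK_invariant G p \<kappa>\<close>: the cardinality of \<open>\<kappa>\<close> is the leading Ulm-Kaplansky invariant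
  of \<open>G\<close> at the prime \<open>p\<close>. A bounded Abelian group has a decomposition as above
  (Pruefer-Baer theorem), and the cardinals occurring in it are uniquely determined.\<close>

definition leading_UK_invariant :: "('a, 'm) monoid_scheme \<Rightarrow> nat \<Rightarrow> 'a set \<Rightarrow> bool" where
  "leading_UK_invariant G p \<kappa> \<longleftrightarrow>
     (\<exists>M n k. cyclic_decomposition G M n k \<and> p \<in> M \<and> \<kappa> = k (n p) p)"

definition group_topology :: "('a, 'm) monoid_scheme \<Rightarrow> 'a topology \<Rightarrow> bool" where
  "group_topology G T \<longleftrightarrow>
     topspace T = carrier G \<and>
     continuous_map (prod_topology T T) T (\<lambda>(x, y). x \<otimes>\<^bsub>G\<^esub> y) \<and>
     continuous_map T T (\<lambda>x. inv\<^bsub>G\<^esub> x)"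

definition circle_group :: "complex monoid" where
  "circle_group = \<lparr>carrier = sphere 0 1, monoid.mult = (*), one = 1\<rparr>"

definition continuous_characters ::
    "('a, 'm) monoid_scheme \<Rightarrow> 'a topology \<Rightarrow> ('a \<Rightarrow> complex) set" where
  "continuous_characters G T =
     {\<phi> \<in> hom G circle_group. continuous_map T (top_of_set (carrier circle_group)) \<phi>}"

definition von_Neumann_radical :: "('a, 'm) monoid_scheme \<Rightarrow> 'a topology \<Rightarrow> 'a set" where
  "von_Neumann_radical G T = (\<Inter>\<phi>\<in>continuous_characters G T. kernel G circle_group \<phi>)"

definition minimally_almost_periodic :: "('a, 'm) monoid_scheme \<Rightarrow> 'a topology \<Rightarrow> bool" where
  "minimally_almost_periodic G T \<longleftrightarrow> von_Neumann_radical G T = carrier G"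

text \<open>Completeness refers to the uniformity of the topological group; for Abelian groups the left,
  right and two-sided uniformities coincide.\<close>

definition group_cauchy_filter ::
    "('a, 'm) monoid_scheme \<Rightarrow> 'a topology \<Rightarrow> 'a filter \<Rightarrow> bool" where
  "group_cauchy_filter G T F \<longleftrightarrow>
     F \<noteq> bot \<and>
     (\<forall>U. openin T U \<and> \<one>\<^bsub>G\<^esub> \<in> U \<longrightarrow>
        (\<exists>A\<subseteq>carrier G. eventually (\<lambda>x. x \<in> A) F \<and> (\<forall>x\<in>A. \<forall>y\<in>A. x \<otimes>\<^bsub>G\<^esub> inv\<^bsub>G\<^esub> y \<in> U)))"

definition complete_group_topology :: "('a, 'm) monoid_scheme \<Rightarrow> 'a topology \<Rightarrow> bool" where
  "complete_group_topology G T \<longleftrightarrow>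
     (\<forall>F. group_cauchy_filter G T F \<longrightarrow> (\<exists>l. limitin T (\<lambda>x. x) l F))"

end

theory Submission
  imports Defs "HOL-Algebra.Free_Abelian_Groups" "HOL-Number_Theory.Cong"
begin

text \<open>Let \<open>m\<close> be the exponent of \<open>G\<close>. A character of \<open>G\<close> has values in the finite set of \<open>m\<close>-th
  roots of unity, so it is continuous if and only if its kernel is open. Minimal almost periodicity
  is therefore a matter of which subgroups contain a neighbourhood of the identity.

  Suppose that the leading invariant at \<open>p\<close> is finite, and let \<open>c = m / p\<close>. The map \<open>x \<mapsto> x^c\<close> kills
  every cyclic summand other than the finitely many of order \<open>p^(n p)\<close>, so its range is finite. In a
  Hausdorff group topology its kernel is then open, being the complement of the preimage of a finite
  set, and the character that reads one coordinate of order \<open>p^(n p)\<close> modulo \<open>p\<close> is trivial on this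
  kernel. Thus there is a nontrivial continuous character (\<open>not_MinAP_if_finite_leading\<close>).

  Suppose that all leading invariants are infinite. One generator of top order for each prime,
  multiplied together, gives an element of order \<open>m\<close>, and there is a sequence \<open>e 0, e 1, \<dots>\<close> of such
  elements with pairwise disjoint supports. List \<open>G\<close> as \<open>g 0, g 1, \<dots>\<close> with every element occurring
  infinitely often, and put \<open>v n = g n * (\<Prod>t\<in>B n. e t)\<close>, where the blocks \<open>B n\<close> of \<open>n + 1\<close> indices are
  disjoint and so far out that the coordinates they use do not occur in \<open>g 0, \<dots>, g n\<close>. Every tail
  of \<open>e 0, v 0, e 1, v 1, \<dots>\<close> generates \<open>G\<close>, so a group topology in which the cyclic groups generated
  by these elements converge to the identity is minimally almost periodic. Such a topology is given by
  the neighbourhoods \<open>sparse \<phi>\<close>, with \<open>\<phi>\<close> tending to infinity, of all products with at most \<open>\<phi> N\<close>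
  nontrivial factors from the first \<open>N\<close> cyclic groups, for every \<open>N\<close>.

  It is Hausdorff (\<open>separated\<close>): if \<open>v n\<close> is the last factor of this kind in a product that equals a
  fixed element, the fresh coordinates of \<open>B n\<close> can only be cancelled by factors \<open>e t\<close> for all \<open>n + 1\<close>
  indices \<open>t \<in> B n\<close>, which is too many if \<open>\<phi>\<close> grows slowly. It is complete (\<open>complete_sparse\<close>): \<open>G\<close> is
  the union of the sets of products of at most \<open>k\<close> factors, each of which behaves like a compact set, so a
  Cauchy filter without cluster points avoids a neighbourhood \<open>sparse (\<lambda>N. \<phi> N + k)\<close> of each of
  them, and a diagonal choice of \<open>\<phi>\<close> contradicts the Cauchy property.

  The hypothesis on the invariants speaks about all cyclic decompositions. To use it, one of them must
  exist; this is the theorem of Pruefer and Baer (\<open>cyclic_decomposition_exists\<close>), proved by induction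
  on the exponent.\<close>

section \<open>Products and powers in subgroups\<close>

lemma (in comm_group) finprod_in_subgroup:
  assumes "subgroup K G" "finite S" "\<And>i. i \<in> S \<Longrightarrow> f i \<in> K"
  shows "finprod G f S \<in> K"
  using assms(2,3)
proof (induction S rule: finite_induct)
  case (insert i S)
  have "f \<in> S \<rightarrow> carrier G" "f i \<in> carrier G"
    using insert.prems subgroup.subset[OF assms(1)] by auto
  then show ?case using insert subgroup.m_closed[OF assms(1)] by simp
qed (simp add: subgroup.one_closed[OF assms(1)])

lemma (in comm_group) gfinprod_in_subgroup:
  assumes "subgroup K G" "\<And>i. i \<in> S \<Longrightarrow> f i \<in> K"
  shows "gfinprod G f S \<in> K"
proof (cases "finite {i \<in> S. f i \<noteq> \<one>}")
  case True
  then have "finprod G f {i \<in> S. f i \<noteq> \<one>} \<in> K"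
    by (rule finprod_in_subgroup[OF assms(1)]) (simp add: assms(2))
  then show ?thesis using True by (simp add: gfinprod_def)
next
  case False
  then show ?thesis using subgroup.one_closed[OF assms(1)] by (simp add: gfinprod_def)
qed

lemma (in group) subgroup_int_pow_closed:
  assumes "subgroup K G" "x \<in> K"
  shows "x [^] (c::int) \<in> K"
proof -
  have "x [^] c = x [^]\<^bsub>G\<lparr>carrier := K\<rparr>\<^esub> c"
    using assms int_pow_consistent by blast
  moreover have "group (G\<lparr>carrier := K\<rparr>)" using assms subgroup_imp_group by blast
  ultimately show ?thesis
    using group.int_pow_closed[of "G\<lparr>carrier := K\<rparr>" x c] assms by simp
qed

lemma (in group) subgroup_mult_cancel:
  assumes "subgroup K G" "x \<otimes> y \<in> K" "x \<in> carrier G" "y \<in> K"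
  shows "x \<in> K"
proof -
  have y: "y \<in> carrier G" "inv y \<in> K"
    using subgroup.mem_carrier[OF assms(1)] subgroup.m_inv_closed[OF assms(1)] assms(4) by simp_all
  have "(x \<otimes> y) \<otimes> inv y \<in> K" using assms(2) y(2) by (rule subgroup.m_closed[OF assms(1)])
  then show ?thesis using assms(3) y by (simp add: m_assoc)
qed

lemma (in group) finite_cyclic_powers:
  assumes "x \<in> carrier G" "x [^] (m::nat) = \<one>" "m > 0"
  shows "finite (range (\<lambda>c::int. x [^] c))"
proof -
  have "x [^] c = x [^] (c mod int m)" for c :: int
  proof -
    have "x [^] c = x [^] (int m * (c div int m) + c mod int m)" by simp
    also have "\<dots> = (x [^] int m) [^] (c div int m) \<otimes> x [^] (c mod int m)"
      using assms(1) by (simp only: int_pow_mult int_pow_pow)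
    also have "\<dots> = x [^] (c mod int m)"
      using assms(1,2) by (simp add: int_pow_int)
    finally show ?thesis .
  qed
  moreover have "c mod int m \<in> {0..<int m}" for c using assms(3) by simp
  ultimately have "range (\<lambda>c::int. x [^] c) \<subseteq> (\<lambda>c. x [^] c) ` {0..<int m}" by blast
  then show ?thesis by (rule finite_subset) simp
qed

lemma (in group) pow_group_exponent:
  assumes "bounded_group G"
  shows "group_exponent G > 0" "x \<in> carrier G \<Longrightarrow> x [^] group_exponent G = \<one>"
proof -
  show "group_exponent G > 0" using assms by (simp add: bounded_group_def)
  show "x [^] group_exponent G = \<one>" if "x \<in> carrier G"
  proof -
    have "ord x dvd group_exponent G" unfolding group_exponent_def using that by (intro dvd_Lcm) blast
    then show ?thesis using pow_eq_id[OF that] by blast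
  qed
qed

section \<open>Direct decompositions of bounded Abelian groups\<close>

context comm_group
begin

lemma finprod_int_pow:
  assumes "finite S" "f \<in> S \<rightarrow> carrier G"
  shows "finprod G f S [^] (c::int) = finprod G (\<lambda>i. f i [^] c) S"
  using assms
proof (induction S rule: finite_induct)
  case (insert i S)
  then have cl: "f \<in> S \<rightarrow> carrier G" "f i \<in> carrier G" by auto
  have "finprod G f (insert i S) [^] c = f i [^] c \<otimes> finprod G f S [^] c"
    using insert.hyps cl by (simp add: int_pow_distrib)
  also have "\<dots> = finprod G (\<lambda>i. f i [^] c) (insert i S)"
    using insert.hyps insert.IH[OF cl(1)] cl by (subst finprod_insert) auto
  finally show ?case .
qed simp

text \<open>The cyclic subgroups generated by the elements of \<open>B\<close> form a direct sum. Elements of \<open>B\<close> may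
  have finite order, so it is the powers and not the exponents that have to be trivial.\<close>

definition power_independent :: "'a set \<Rightarrow> bool" where
  "power_independent B \<longleftrightarrow> (\<forall>S (f :: 'a \<Rightarrow> int). finite S \<longrightarrow> S \<subseteq> B \<longrightarrow>
     finprod G (\<lambda>b. b [^] f b) S = \<one> \<longrightarrow> (\<forall>b\<in>S. b [^] f b = \<one>))"

lemma power_independentD:
  fixes f :: "'a \<Rightarrow> int"
  assumes "power_independent B" "finite S" "S \<subseteq> B" "finprod G (\<lambda>b. b [^] f b) S = \<one>" "b \<in> S"
  shows "b [^] f b = \<one>"
  using assms unfolding power_independent_def by blast

definition power_span :: "'a set \<Rightarrow> 'a set" where
  "power_span B = {finprod G (\<lambda>b. b [^] f b) S | S (f :: 'a \<Rightarrow> int). finite S \<and> S \<subseteq> B}"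

lemma power_spanI: "finite S \<Longrightarrow> S \<subseteq> B \<Longrightarrow> finprod G (\<lambda>b. b [^] (f b :: int)) S \<in> power_span B"
  unfolding power_span_def by blast

lemma subset_power_span:
  assumes "B \<subseteq> carrier G" shows "B \<subseteq> power_span B"
proof
  fix b assume b: "b \<in> B"
  then have bG: "b \<in> carrier G" using assms by blast
  have "finprod G (\<lambda>b. b [^] (1::int)) {b} \<in> power_span B"
    using b by (intro power_spanI[where f = "\<lambda>_. 1"]) auto
  then show "b \<in> power_span B" using bG by simp
qed

lemma power_span_closed:
  assumes "B \<subseteq> carrier G" "x \<in> power_span B" shows "x \<in> carrier G"
proof -
  obtain S f where "x = finprod G (\<lambda>b. b [^] (f b :: int)) S" "S \<subseteq> B"
    using assms(2) unfolding power_span_def by blast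
  then show ?thesis using assms(1) by (auto intro!: finprod_closed)
qed

lemma power_span_one: "\<one> \<in> power_span B"
  using power_spanI[of "{}" B "\<lambda>_. 0"] by simp

lemma power_span_mult:
  assumes B: "B \<subseteq> carrier G" and x: "x \<in> power_span B" and y: "y \<in> power_span B"
  shows "x \<otimes> y \<in> power_span B"
proof -
  obtain S f where S: "x = finprod G (\<lambda>b. b [^] (f b :: int)) S" "finite S" "S \<subseteq> B"
    using x unfolding power_span_def by blast
  obtain T g where T: "y = finprod G (\<lambda>b. b [^] (g b :: int)) T" "finite T" "T \<subseteq> B"
    using y unfolding power_span_def by blast
  define f' where "f' b = (if b \<in> S then f b else 0)" for b
  define g' where "g' b = (if b \<in> T then g b else 0)" for b
  have ST: "S \<union> T \<subseteq> carrier G" using S T B by blast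
  have "x = finprod G (\<lambda>b. b [^] f' b) (S \<union> T)"
    unfolding S(1) using S(2) T(2) ST
    by (intro finprod_mono_neutral_cong_left) (auto simp: f'_def)
  moreover have "y = finprod G (\<lambda>b. b [^] g' b) (S \<union> T)"
    unfolding T(1) using S(2) T(2) ST
    by (intro finprod_mono_neutral_cong_left) (auto simp: g'_def)
  moreover have "finprod G (\<lambda>b. b [^] f' b \<otimes> b [^] g' b) (S \<union> T) =
      finprod G (\<lambda>b. b [^] f' b) (S \<union> T) \<otimes> finprod G (\<lambda>b. b [^] g' b) (S \<union> T)"
    using ST by (intro finprod_multf) auto
  moreover have "finprod G (\<lambda>b. b [^] f' b \<otimes> b [^] g' b) (S \<union> T) =
      finprod G (\<lambda>b. b [^] (f' b + g' b)) (S \<union> T)"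
    using ST by (intro finprod_cong') (auto simp: int_pow_mult)
  ultimately have "x \<otimes> y = finprod G (\<lambda>b. b [^] (f' b + g' b)) (S \<union> T)" by simp
  also have "\<dots> \<in> power_span B" using S T by (intro power_spanI) auto
  finally show ?thesis .
qed

lemma power_span_int_pow:
  assumes B: "B \<subseteq> carrier G" and x: "x \<in> power_span B"
  shows "x [^] (c::int) \<in> power_span B"
proof -
  obtain S f where S: "x = finprod G (\<lambda>b. b [^] (f b :: int)) S" "finite S" "S \<subseteq> B"
    using x unfolding power_span_def by blast
  have SG: "S \<subseteq> carrier G" using S B by blast
  have "x [^] c = finprod G (\<lambda>b. (b [^] f b) [^] c) S"
    unfolding S(1) using S(2) SG by (intro finprod_int_pow) auto
  also have "\<dots> = finprod G (\<lambda>b. b [^] (f b * c)) S"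
    using SG by (intro finprod_cong') (auto simp: int_pow_pow)
  also have "\<dots> \<in> power_span B" using S by (intro power_spanI) auto
  finally show ?thesis .
qed

lemma power_span_inv:
  assumes "B \<subseteq> carrier G" "x \<in> power_span B" shows "inv x \<in> power_span B"
  using power_span_int_pow[OF assms, of "-1"] power_span_closed[OF assms] by (simp add: int_pow_neg)

definition prime_power_order :: "'a \<Rightarrow> bool" where
  "prime_power_order b \<longleftrightarrow> (\<exists>q i. Factorial_Ring.prime q \<and> 1 \<le> i \<and> ord b = q ^ i)"

lemma prime_power_orderI:
  assumes "x \<in> carrier G" "x [^] (q ^ i :: nat) = \<one>" "Factorial_Ring.prime q" "x \<noteq> \<one>"
  shows "prime_power_order x"
proof -
  have "ord x dvd q ^ i" using assms(1,2) pow_eq_id by blast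
  then obtain j where j: "ord x = q ^ j" using assms(3) divides_primepow_nat by blast
  have "j \<noteq> 0" using j assms(1,4) ord_eq_1 by (metis power_0)
  then show ?thesis using j assms(3) unfolding prime_power_order_def by (metis One_nat_def Suc_leI neq0_conv)
qed

text \<open>A root \<open>c\<close> of \<open>b\<close> that does not spoil independence. If \<open>b\<close> has \<open>p\<close>-power order, any \<open>p\<close>-th root
  will do: a relation \<open>b^f = 1\<close> forces \<open>p\<close> to divide \<open>f\<close>, so \<open>c^f\<close> is a power of \<open>b\<close>. If the order of \<open>b\<close>
  is prime to \<open>p\<close>, the root can be taken among the powers of \<open>b\<close>. The last property is the one that
  transfers independence from the elements \<open>b\<close> to the elements \<open>c\<close>.\<close>

lemma pow_root:
  assumes H: "subgroup H G" and p: "Factorial_Ring.prime p"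
    and x: "x \<in> H" and b: "b = x [^] (p::nat)" "prime_power_order b"
  obtains c where "c \<in> H" "c [^] p = b" "prime_power_order c"
    "\<And>f::int. b [^] f = \<one> \<Longrightarrow> \<exists>f'::int. c [^] f = b [^] f'"
proof -
  obtain q i where q: "Factorial_Ring.prime q" "1 \<le> i" "ord b = q ^ i"
    using b(2) unfolding prime_power_order_def by blast
  have xG: "x \<in> carrier G" using x H subgroup.mem_carrier by metis
  have bG: "b \<in> carrier G" using b xG by simp
  have "1 < q ^ i" using q prime_gt_1_nat by (intro one_less_power) auto
  then have b1: "b \<noteq> \<one>" using q(3) ord_eq_1[OF bG] by (metis less_irrefl)
  show ?thesis
  proof (cases "q = p")
    case True
    show ?thesis
    proof (rule that[of x])
      have "x [^] (p ^ Suc i) = (x [^] p) [^] (p ^ i)" using xG by (simp add: nat_pow_pow)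
      also have "\<dots> = b [^] ord b" unfolding q(3) True by (simp only: b(1))
      finally have "x [^] (p ^ Suc i) = b [^] ord b" .
      then have "x [^] (p ^ Suc i) = \<one>" using bG by simp
      moreover have "x \<noteq> \<one>" using b1 b(1) by auto
      ultimately show "prime_power_order x" using prime_power_orderI xG p by blast
      fix f :: int assume "b [^] f = \<one>"
      then have "int (q ^ i) dvd f" using int_pow_eq_id[OF bG] q(3) by simp
      moreover have "int p dvd int (q ^ i)" using True q(2) by (simp add: dvd_power)
      ultimately have "int p dvd f" by (rule dvd_trans[rotated])
      then obtain f' where "f = int p * f'" by blast
      then have "x [^] f = (x [^] int p) [^] f'" using xG by (simp add: int_pow_pow)
      then have "x [^] f = b [^] f'" by (simp only: b(1) int_pow_int)
      then show "\<exists>f'::int. x [^] f = b [^] f'" ..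
    qed (use x b in auto)
  next
    case False
    then have "coprime p q" using primes_coprime[OF p q(1)] by blast
    then have "coprime p (q ^ i)" by simp
    then have "coprime (int p) (int (q ^ i))" by (simp only: coprime_int_iff)
    then obtain r where r: "[int p * r = 1] (mod int (q ^ i))"
      using cong_solve_coprime_int by blast
    show ?thesis
    proof (rule that[of "b [^] r"])
      show "b [^] r \<in> H"
      proof -
        have "b \<in> H" unfolding b(1)
          using subgroup_int_pow_closed[OF H x, of "int p"] by (simp only: int_pow_int)
        then show ?thesis using H subgroup_int_pow_closed by blast
      qed
      have "int (ord b) dvd 1 - r * int p"
        using r q(3) by (simp add: cong_iff_dvd_diff dvd_diff_commute mult.commute)
      then have "b [^] (r * int p) = b [^] (1::int)" using int_pow_eq[OF bG] by blast
      then show root: "(b [^] r) [^] p = b"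
        using bG by (simp add: int_pow_pow int_pow_int[symmetric])
      have "(b [^] r) [^] (q ^ i) = b [^] (r * int (q ^ i))"
        using bG by (simp only: int_pow_pow flip: int_pow_int)
      also have "\<dots> = \<one>" using int_pow_eq_id[OF bG] q(3) by simp
      finally have "(b [^] r) [^] (q ^ i) = \<one>" .
      moreover have "b [^] r \<noteq> \<one>" using root b1 by auto
      ultimately show "prime_power_order (b [^] r)" using prime_power_orderI bG q(1) by blast
      fix f :: int
      have "(b [^] r) [^] f = b [^] (r * f)" using bG by (simp add: int_pow_pow)
      then show "\<exists>f'::int. (b [^] r) [^] f = b [^] f'" ..
    qed
  qed
qed

text \<open>The \<open>p\<close>-th power of a relation between the roots is a relation between the elements of \<open>B\<close>, hence
  trivial. So by \<open>tors\<close> each factor of the original relation is a power of an element of \<open>B\<close>, and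
  the original relation is itself a relation in \<open>B\<close>.\<close>

lemma power_independent_roots:
  assumes B: "power_independent B" "B \<subseteq> carrier G"
    and c: "\<And>b. b \<in> B \<Longrightarrow> c b \<in> carrier G" "\<And>b. b \<in> B \<Longrightarrow> c b [^] (p::nat) = b"
    and tors: "\<And>b f::int. b \<in> B \<Longrightarrow> b [^] f = \<one> \<Longrightarrow> \<exists>f'::int. c b [^] f = b [^] f'"
  shows "power_independent (c ` B)"
  unfolding power_independent_def
proof (intro allI impI)
  fix S and f :: "'a \<Rightarrow> int"
  assume S: "finite S" "S \<subseteq> c ` B" and one: "finprod G (\<lambda>b. b [^] f b) S = \<one>"
  obtain T where T: "T \<subseteq> B" "finite T" "S = c ` T"
    using S finite_subset_image by metis
  have inj: "inj_on c T" using c(2) T(1) by (metis inj_onI subsetD)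
  have TG: "T \<subseteq> carrier G" "\<And>b. b \<in> T \<Longrightarrow> c b \<in> carrier G" using T B c by auto
  have sum: "finprod G (\<lambda>b. c b [^] f (c b)) T = \<one>"
    using one TG inj unfolding T(3) by (subst (asm) finprod_reindex) auto
  have "finprod G (\<lambda>b. (c b [^] f (c b)) [^] int p) T = \<one>"
    using finprod_int_pow[OF T(2), of "\<lambda>b. c b [^] f (c b)" "int p"] sum TG by simp
  moreover have "(c b [^] f (c b)) [^] int p = b [^] f (c b)" if "b \<in> T" for b
  proof -
    have "(c b [^] f (c b)) [^] int p = (c b [^] int p) [^] f (c b)"
      using TG(2)[OF that] by (simp only: int_pow_pow mult.commute)
    then show ?thesis using c(2) T(1) that by (simp add: int_pow_int subsetD)
  qed
  ultimately have "finprod G (\<lambda>b. b [^] f (c b)) T = \<one>"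
    using TG by (subst (asm) finprod_cong') auto
  then have one': "b [^] f (c b) = \<one>" if "b \<in> T" for b
    using power_independentD[OF B(1) T(2,1), of "\<lambda>b. f (c b)"] that by simp
  have "\<forall>b\<in>T. \<exists>f'::int. c b [^] f (c b) = b [^] f'"
  proof
    fix b assume b: "b \<in> T"
    then have "b \<in> B" using T(1) by blast
    then show "\<exists>f'::int. c b [^] f (c b) = b [^] f'" using one'[OF b] by (rule tors)
  qed
  from bchoice[OF this] obtain g :: "'a \<Rightarrow> int"
    where g: "\<And>b. b \<in> T \<Longrightarrow> c b [^] f (c b) = b [^] g b" by blast
  then have "finprod G (\<lambda>b. b [^] g b) T = \<one>"
    using sum TG by (subst (asm) finprod_cong') auto
  then have "\<forall>b\<in>T. b [^] g b = \<one>"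
    using power_independentD[OF B(1) T(2,1)] by simp
  then show "\<forall>b\<in>S. b [^] f b = \<one>" using g T(3) by simp
qed

text \<open>Elements of order \<open>p\<close> behave as in a vector space over the field with \<open>p\<close> elements: if a relation
  involves a nontrivial power of \<open>g\<close>, the exponent is invertible modulo \<open>p\<close> and \<open>g\<close> is in the span.\<close>

lemma power_independent_insert:
  assumes B: "power_independent B" "B \<subseteq> carrier G" and p: "Factorial_Ring.prime p"
    and g: "g \<in> carrier G" "g [^] (p::nat) = \<one>" "g \<notin> power_span B"
  shows "power_independent (insert g B)"
  unfolding power_independent_def
proof (intro allI impI)
  fix S and f :: "'a \<Rightarrow> int"
  assume S: "finite S" "S \<subseteq> insert g B" and one: "finprod G (\<lambda>b. b [^] f b) S = \<one>"
  show "\<forall>b\<in>S. b [^] f b = \<one>"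
  proof (cases "g \<in> S")
    case False
    then show ?thesis using B(1) S one unfolding power_independent_def by blast
  next
    case True
    define T where "T = S - {g}"
    have T: "finite T" "T \<subseteq> B" "g \<notin> T" "S = insert g T" using S True by (auto simp: T_def)
    define t where "t = finprod G (\<lambda>b. b [^] f b) T"
    have tspan: "t \<in> power_span B" unfolding t_def using T by (intro power_spanI)
    then have tG: "t \<in> carrier G" using power_span_closed B(2) by blast
    have split: "g [^] f g \<otimes> t = \<one>"
      using one T B(2) g(1) unfolding T(4) t_def by (subst (asm) finprod_insert) auto
    have "int p dvd f g"
    proof (rule ccontr)
      assume "\<not> int p dvd f g"
      then have "coprime (f g) (int p)"
        using p prime_imp_coprime[of "int p" "f g"] by (simp add: coprime_commute)
      then obtain r where r: "[f g * r = 1] (mod int p)" using cong_solve_coprime_int by blast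
      have "g [^] int p = \<one>" using g(2) by (simp add: int_pow_int)
      then have "int (ord g) dvd int p" using int_pow_eq_id[OF g(1)] by blast
      moreover have "int p dvd 1 - f g * r" using r by (simp add: cong_iff_dvd_diff dvd_diff_commute)
      ultimately have "int (ord g) dvd 1 - f g * r" by (rule dvd_trans)
      then have "g [^] (f g * r) = g [^] (1::int)" using int_pow_eq[OF g(1)] by blast
      then have "g = (g [^] f g) [^] r" using g(1) by (simp add: int_pow_pow)
      moreover have "g [^] f g = inv t"
        using split tG g(1) by (metis inv_equality int_pow_closed)
      ultimately have "g \<in> power_span B" using power_span_int_pow[OF B(2) power_span_inv[OF B(2) tspan]] by metis
      then show False using g(3) by blast
    qed
    then obtain s where "f g = int p * s" by blast
    then have "g [^] f g = (g [^] int p) [^] s" using g(1) by (simp add: int_pow_pow)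
    then have g1: "g [^] f g = \<one>" using g(2) by (simp add: int_pow_int)
    then have "finprod G (\<lambda>b. b [^] f b) T = \<one>" using split tG t_def by simp
    then show ?thesis using B(1) T g1 unfolding power_independent_def by blast
  qed
qed

lemma power_independent_Union_chain:
  assumes "\<C> \<noteq> {}" "subset.chain \<A> \<C>" "\<And>B. B \<in> \<C> \<Longrightarrow> power_independent B"
  shows "power_independent (\<Union>\<C>)"
  unfolding power_independent_def
proof (intro allI impI)
  fix S and f :: "'a \<Rightarrow> int"
  assume S: "finite S" "S \<subseteq> \<Union>\<C>" "finprod G (\<lambda>b. b [^] f b) S = \<one>"
  obtain B where "B \<in> \<C>" "S \<subseteq> B"
    using finite_subset_Union_chain[OF S(1,2) assms(1,2)] by blast
  then show "\<forall>b\<in>S. b [^] f b = \<one>" using assms(3) S unfolding power_independent_def by blast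
qed

text \<open>By induction on \<open>m\<close>: for a prime \<open>p\<close> dividing \<open>m\<close>, the subgroup of \<open>p\<close>-th powers has
  a basis, whose elements have independent \<open>p\<close>-th roots in \<open>H\<close>. The span of these roots has the same \<open>p\<close>-th
  powers as \<open>H\<close>, so together with the elements of order \<open>p\<close> it generates \<open>H\<close>. It remains to add
  elements of order \<open>p\<close> to the roots, as many as independence permits.\<close>

theorem prime_power_basis:
  assumes "subgroup H G" "\<And>x. x \<in> H \<Longrightarrow> x [^] (m::nat) = \<one>" "m > 0"
  shows "\<exists>B\<subseteq>H. power_independent B \<and> (\<forall>b\<in>B. prime_power_order b) \<and> H \<subseteq> power_span B"
  using assms
proof (induction m arbitrary: H rule: less_induct)
  case (less m)
  note H = less.prems(1)
  have HG: "H \<subseteq> carrier G" by (rule subgroup.subset[OF H])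
  show ?case
  proof (cases "m = 1")
    case True
    have "H \<subseteq> {\<one>}"
    proof
      fix x assume x: "x \<in> H"
      then have "x [^] (1::nat) = \<one>" using less.prems(2) True by blast
      moreover have "x [^] (1::nat) = x" using x HG by (intro nat_pow_eone) blast
      ultimately show "x \<in> {\<one>}" by simp
    qed
    moreover have "power_independent {}" by (auto simp: power_independent_def)
    ultimately show ?thesis using power_span_one by (intro exI[of _ "{}"]) auto
  next
    case False
    then obtain p where p: "Factorial_Ring.prime p" "p dvd m"
      using prime_factor_nat by blast
    then obtain m' where m': "m = p * m'" by blast
    have m'_less: "m' < m" "m' > 0" using m' less.prems(3) prime_gt_1_nat[OF p(1)] by auto
    define H' where "H' = (\<lambda>x. x [^] p) ` H"
    have "subgroup H' G"
    proof
      show "H' \<subseteq> carrier G" using HG by (auto simp: H'_def)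
      show "\<one> \<in> H'" unfolding H'_def using subgroup.one_closed[OF H] by (metis imageI nat_pow_one)
      show "x \<otimes> y \<in> H'" if xy: "x \<in> H'" "y \<in> H'" for x y
      proof -
        obtain u v where uv: "u \<in> H" "v \<in> H" "x = u [^] p" "y = v [^] p"
          using xy unfolding H'_def by blast
        then have "x \<otimes> y = (u \<otimes> v) [^] p" using HG by (simp add: nat_pow_distrib subsetD)
        then show ?thesis unfolding H'_def using subgroup.m_closed[OF H] uv by blast
      qed
      show "inv x \<in> H'" if x: "x \<in> H'" for x
      proof -
        obtain u where u: "u \<in> H" "x = u [^] p" using x unfolding H'_def by blast
        then have "inv x = (inv u) [^] p" using HG by (simp add: nat_pow_inv subsetD)
        then show ?thesis unfolding H'_def using subgroup.m_inv_closed[OF H] u by blast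
      qed
    qed
    moreover have "x [^] m' = \<one>" if x: "x \<in> H'" for x
    proof -
      obtain u where u: "u \<in> H" "x = u [^] p" using x unfolding H'_def by blast
      then have "x [^] m' = u [^] m" using HG by (simp add: nat_pow_pow m' subsetD)
      then show ?thesis using less.prems(2) u by simp
    qed
    ultimately obtain B' where B': "B' \<subseteq> H'" "power_independent B'" "\<forall>b\<in>B'. prime_power_order b"
      "H' \<subseteq> power_span B'"
      using less.IH[OF m'_less(1), of H'] m'_less(2) by blast
    have B'G: "B' \<subseteq> carrier G" using B'(1) HG by (auto simp: H'_def)
    have "\<forall>b\<in>B'. \<exists>c. c \<in> H \<and> c [^] p = b \<and> prime_power_order c \<and>
        (\<forall>f::int. b [^] f = \<one> \<longrightarrow> (\<exists>f'::int. c [^] f = b [^] f'))"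
    proof
      fix b assume b: "b \<in> B'"
      then obtain x where "x \<in> H" "b = x [^] p" using B'(1) unfolding H'_def by blast
      then show "\<exists>c. c \<in> H \<and> c [^] p = b \<and> prime_power_order c \<and>
          (\<forall>f::int. b [^] f = \<one> \<longrightarrow> (\<exists>f'::int. c [^] f = b [^] f'))"
        using pow_root[OF H p(1)] b B'(3) by metis
    qed
    from bchoice[OF this] obtain c where c: "\<And>b. b \<in> B' \<Longrightarrow> c b \<in> H"
      "\<And>b. b \<in> B' \<Longrightarrow> c b [^] p = b" "\<And>b. b \<in> B' \<Longrightarrow> prime_power_order (c b)"
      "\<And>b f::int. b \<in> B' \<Longrightarrow> b [^] f = \<one> \<Longrightarrow> \<exists>f'::int. c b [^] f = b [^] f'"
      by blast
    define C where "C = c ` B'"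
    have C: "power_independent C" "C \<subseteq> H"
      unfolding C_def using c HG by (auto intro!: power_independent_roots[OF B'(2) B'G, of c p])
    \<comment> \<open>Only elements of order \<open>p\<close> are added to the roots, so a maximal set spans all of them.\<close>
    define \<A> where "\<A> = {B. C \<subseteq> B \<and> B \<subseteq> C \<union> {x \<in> H. x [^] p = \<one> \<and> x \<noteq> \<one>} \<and> power_independent B}"
    have "\<exists>B\<in>\<A>. \<forall>X\<in>\<A>. B \<subseteq> X \<longrightarrow> X = B"
    proof (rule subset_Zorn_nonempty)
      show "\<A> \<noteq> {}" using C by (auto simp: \<A>_def)
      fix \<C> assume \<C>: "\<C> \<noteq> {}" "subset.chain \<A> \<C>"
      then have sub: "\<C> \<subseteq> \<A>" by (simp add: subset.chain_def)
      then have "power_independent (\<Union>\<C>)"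
        using power_independent_Union_chain[OF \<C>] by (auto simp: \<A>_def)
      moreover have "C \<subseteq> \<Union>\<C>" "\<Union>\<C> \<subseteq> C \<union> {x \<in> H. x [^] p = \<one> \<and> x \<noteq> \<one>}"
        using sub \<C>(1) by (auto simp: \<A>_def)
      ultimately show "\<Union>\<C> \<in> \<A>" by (simp add: \<A>_def)
    qed
    then obtain B where B: "B \<in> \<A>" "\<And>X. X \<in> \<A> \<Longrightarrow> B \<subseteq> X \<Longrightarrow> X = B" by blast
    then have CB: "C \<subseteq> B" "power_independent B" and BH: "B \<subseteq> H"
      and Bsub: "B \<subseteq> C \<union> {x \<in> H. x [^] p = \<one> \<and> x \<noteq> \<one>}"
      using C(2) by (auto simp: \<A>_def)
    have BG: "B \<subseteq> carrier G" using BH HG by blast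
    have tors: "g \<in> power_span B" if g: "g \<in> H" "g [^] p = \<one>" for g
    proof (rule ccontr)
      assume no: "g \<notin> power_span B"
      then have g1: "g \<noteq> \<one>" "g \<notin> B" using power_span_one subset_power_span[OF BG] by auto
      have "power_independent (insert g B)"
        using power_independent_insert[OF CB(2) BG p(1) _ g(2) no] g(1) HG by blast
      then have "insert g B \<in> \<A>" using B(1) g g1 by (auto simp: \<A>_def)
      then have "insert g B = B" using B(2) by blast
      then show False using g1 by blast
    qed
    have "H \<subseteq> power_span B"
    proof
      fix g assume g: "g \<in> H"
      then have gG: "g \<in> carrier G" using HG by blast
      have "g [^] p \<in> power_span B'" using g B'(4) by (auto simp: H'_def)
      then obtain S f where S: "g [^] p = finprod G (\<lambda>b. b [^] (f b :: int)) S" "finite S" "S \<subseteq> B'"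
        unfolding power_span_def by blast
      have SG: "S \<subseteq> carrier G" "\<And>b. b \<in> S \<Longrightarrow> c b \<in> carrier G" using S B'G c(1) HG by auto
      \<comment> \<open>An element of the span of the roots with the same \<open>p\<close>-th power as \<open>g\<close>.\<close>
      define z where "z = finprod G (\<lambda>b. c b [^] f b) S"
      have zH: "z \<in> H"
        unfolding z_def using S c(1)
        by (intro finprod_in_subgroup[OF H]) (auto intro!: subgroup_int_pow_closed[OF H])
      then have zG: "z \<in> carrier G" using HG by blast
      have inj: "inj_on c S" using c(2) S(3) by (metis inj_onI subsetD)
      have "z = finprod G (\<lambda>y. y [^] f (the_inv_into S c y)) (c ` S)"
        unfolding z_def using SG inj
        by (subst finprod_reindex) (auto simp: the_inv_into_f_f intro!: finprod_cong')
      also have "\<dots> \<in> power_span B" using S CB(1) by (intro power_spanI) (auto simp: C_def)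
      finally have zspan: "z \<in> power_span B" .
      have "z [^] int p = finprod G (\<lambda>b. (c b [^] f b) [^] int p) S"
        unfolding z_def using S(2) SG by (intro finprod_int_pow) auto
      also have "\<dots> = finprod G (\<lambda>b. b [^] f b) S"
      proof (rule finprod_cong')
        fix b assume b: "b \<in> S"
        have "(c b [^] f b) [^] int p = (c b [^] int p) [^] f b"
          using SG(2)[OF b] by (simp only: int_pow_pow mult.commute)
        then show "(c b [^] f b) [^] int p = b [^] f b"
          using c(2) S(3) b by (simp add: int_pow_int subsetD)
      qed (use SG in auto)
      finally have zp: "z [^] p = g [^] p" using S(1) by (simp add: int_pow_int)
      have "(g \<otimes> inv z) [^] p = g [^] p \<otimes> inv (z [^] p)"
        using gG zG by (simp add: nat_pow_distrib nat_pow_inv)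
      also have "\<dots> = \<one>" using zp gG by simp
      finally have "g \<otimes> inv z \<in> power_span B"
        using tors g zH subgroup.m_closed[OF H] subgroup.m_inv_closed[OF H] by simp
      then have "(g \<otimes> inv z) \<otimes> z \<in> power_span B" using power_span_mult[OF BG] zspan by blast
      then show "g \<in> power_span B" using gG zG by (simp add: m_assoc)
    qed
    moreover have "prime_power_order b" if b: "b \<in> B" for b
    proof (cases "b \<in> C")
      case True then show ?thesis using c(3) by (auto simp: C_def)
    next
      case False
      then have "b [^] (p ^ 1) = \<one>" "b \<noteq> \<one>" "b \<in> carrier G" using Bsub b HG by auto
      then show ?thesis using prime_power_orderI p(1) by blast
    qed
    ultimately show ?thesis using BH CB(2) by blast
  qed
qed

lemma int_pow_mod_ord:
  assumes "x \<in> carrier G" shows "x [^] (c mod int (ord x)) = x [^] (c::int)"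
  unfolding int_pow_eq[OF assms] by (rule dvd_minus_mod)

text \<open>A basis gives a direct decomposition; the index set is a copy of \<open>B\<close>, so that the summands can carry
  labels, here the prime and the exponent of the order.\<close>

lemma sum_group_iso_of_basis:
  fixes \<iota> :: "'a \<Rightarrow> 'i" and q :: "'i \<Rightarrow> nat"
  assumes B: "B \<subseteq> carrier G" "power_independent B" "carrier G \<subseteq> power_span B"
    and \<iota>: "inj_on \<iota> B" and proj: "\<And>b. b \<in> B \<Longrightarrow> proj (\<iota> b) = b"
    and q: "\<And>b. b \<in> B \<Longrightarrow> q (\<iota> b) = ord b" "\<And>b. b \<in> B \<Longrightarrow> 0 < ord b"
  shows "G \<cong> sum_group (\<iota> ` B) (\<lambda>a. integer_mod_group (q a))"
proof -
  let ?S = "sum_group (\<iota> ` B) (\<lambda>a. integer_mod_group (q a))"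
  define \<Phi> where "\<Phi> x = gfinprod G (\<lambda>a. proj a [^] (x a :: int)) (\<iota> ` B)" for x
  have grp: "group ?S" by simp
  have carrier_S: "carrier ?S = {x \<in> \<Pi>\<^sub>E a\<in>\<iota> ` B. {0..<int (q a)}. finite {a \<in> \<iota> ` B. x a \<noteq> 0}}"
    using q by (auto simp: carrier_sum_group carrier_integer_mod_group PiE_iff)
  have "(\<lambda>c. proj a [^] (c::int)) \<in> hom (integer_mod_group (q a)) G" if a: "a \<in> \<iota> ` B" for a
  proof (rule homI)
    obtain b where b: "b \<in> B" "a = \<iota> b" using a by blast
    then have bG: "b \<in> carrier G" using B(1) by blast
    show "proj a [^] c \<in> carrier G" for c :: int using proj b bG by simp
    show "proj a [^] (c \<otimes>\<^bsub>integer_mod_group (q a)\<^esub> d) = proj a [^] c \<otimes> proj a [^] d" for c d :: int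
      using proj b bG q(1) int_pow_mod_ord[OF bG, of "c + d"] by (simp add: int_pow_mult)
  qed
  then have "\<Phi> \<in> hom ?S G" unfolding \<Phi>_def by (intro hom_group_sum) auto
  then interpret \<Phi>: group_hom ?S G \<Phi>
    using grp by (simp add: group_hom_def group_hom_axioms_def is_group)
  have reindex: "finprod G (\<lambda>a. proj a [^] x a) (\<iota> ` T) = finprod G (\<lambda>b. b [^] x (\<iota> b)) T"
    if T: "T \<subseteq> B" for x :: "'i \<Rightarrow> int" and T
  proof -
    have TG: "proj (\<iota> b) \<in> carrier G" "b \<in> carrier G" if b: "b \<in> T" for b
    proof -
      have "b \<in> B" using b T by blast
      then show "proj (\<iota> b) \<in> carrier G" "b \<in> carrier G" using B(1) proj by auto
    qed
    have "finprod G (\<lambda>a. proj a [^] x a) (\<iota> ` T) = finprod G (\<lambda>b. proj (\<iota> b) [^] x (\<iota> b)) T"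
      using TG inj_on_subset[OF \<iota> T] by (intro finprod_reindex) auto
    also have "\<dots> = finprod G (\<lambda>b. b [^] x (\<iota> b)) T"
      using TG proj T by (intro finprod_cong') (auto simp: subset_iff)
    finally show ?thesis .
  qed
  have "\<Phi> \<in> iso ?S G"
  proof (rule isoI)
    show "\<Phi> \<in> hom ?S G" by fact
    show "bij_betw \<Phi> (carrier ?S) (carrier G)"
      unfolding bij_betw_def
    proof
      show "inj_on \<Phi> (carrier ?S)"
        unfolding \<Phi>.inj_on_one_iff
      proof (intro allI impI)
        fix x assume x: "x \<in> carrier ?S" and one: "\<Phi> x = \<one>"
        define U where "U = {a \<in> \<iota> ` B. proj a [^] x a \<noteq> \<one>}"
        have "U \<subseteq> {a \<in> \<iota> ` B. x a \<noteq> 0}" by (auto simp: U_def)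
        moreover have "finite {a \<in> \<iota> ` B. x a \<noteq> 0}" using x by (simp add: carrier_S)
        ultimately have finU: "finite U" by (rule finite_subset)
        then obtain T where T: "T \<subseteq> B" "finite T" "U = \<iota> ` T"
          using finite_subset_image[of U \<iota> B] by (auto simp: U_def)
        have "finprod G (\<lambda>a. proj a [^] x a) U = \<one>"
          using one finU by (simp add: \<Phi>_def gfinprod_def U_def)
        then have T1: "finprod G (\<lambda>b. b [^] x (\<iota> b)) T = \<one>"
          using reindex[OF T(1), of x] T(3) by simp
        have triv: "b [^] x (\<iota> b) = \<one>" if b: "b \<in> B" for b
        proof (cases "b \<in> T")
          case True
          then show ?thesis using power_independentD[OF B(2) T(2,1), of "\<lambda>b. x (\<iota> b)"] T1 by simp
        next
          case False
          then have "\<iota> b \<notin> U" using T(1,3) \<iota> b by (metis inj_on_image_mem_iff)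
          then show ?thesis using b proj by (simp add: U_def)
        qed
        have zero: "x (\<iota> b) = 0" if b: "b \<in> B" for b
        proof -
          have "int (ord b) dvd x (\<iota> b)" using triv[OF b] int_pow_eq_id B(1) b by blast
          moreover have "x (\<iota> b) \<in> {0..<int (q (\<iota> b))}"
            using PiE_mem[of x "\<iota> ` B" "\<lambda>a. {0..<int (q a)}" "\<iota> b"] x b by (simp add: carrier_S)
          ultimately show ?thesis using q(1)[OF b] zdvd_imp_le[of "int (ord b)" "x (\<iota> b)"]
            by (cases "x (\<iota> b) = 0") auto
        qed
        have "x \<in> extensional (\<iota> ` B)" using x by (simp add: carrier_S PiE_def)
        then have "x = (\<lambda>a\<in>\<iota> ` B. 0)" by (rule extensionalityI) (auto simp: zero)
        then show "x = \<one>\<^bsub>?S\<^esub>" by simp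
      qed
      show "\<Phi> ` carrier ?S = carrier G"
      proof
        show "\<Phi> ` carrier ?S \<subseteq> carrier G" using \<Phi>.hom_closed by blast
        show "carrier G \<subseteq> \<Phi> ` carrier ?S"
        proof
          fix y assume "y \<in> carrier G"
          then obtain T f where T: "y = finprod G (\<lambda>b. b [^] (f b :: int)) T" "finite T" "T \<subseteq> B"
            using B(3) unfolding power_span_def by blast
          define x where "x = (\<lambda>a\<in>\<iota> ` B. if a \<in> \<iota> ` T then f (proj a) mod int (q a) else 0)"
          have "finite {a \<in> \<iota> ` B. x a \<noteq> 0}"
            by (rule finite_subset[of _ "\<iota> ` T"]) (use T(2) in \<open>auto simp: x_def split: if_splits\<close>)
          moreover have "x \<in> (\<Pi>\<^sub>E a\<in>\<iota> ` B. {0..<int (q a)})"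
            using q by (auto simp: x_def)
          ultimately have "x \<in> carrier ?S" unfolding carrier_S by blast
          moreover have "\<Phi> x = y"
          proof -
            have TB: "\<iota> ` T \<subseteq> \<iota> ` B" using T(3) by blast
            have cl: "proj a \<in> carrier G" if "a \<in> \<iota> ` B" for a using that proj B(1) by auto
            have "\<Phi> x = gfinprod G (\<lambda>a. proj a [^] x a) (\<iota> ` T)"
              unfolding \<Phi>_def using TB cl
              by (intro gfinprod_mono_neutral_cong_right) (auto simp: x_def)
            also have "\<dots> = finprod G (\<lambda>a. proj a [^] x a) (\<iota> ` T)"
              using T(2) TB cl by (intro gfinprod_eq_finprod) auto
            also have "\<dots> = finprod G (\<lambda>b. b [^] x (\<iota> b)) T" by (rule reindex[OF T(3)])
            also have "\<dots> = y"
              unfolding T(1)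
            proof (rule finprod_cong')
              fix b assume b: "b \<in> T"
              then have bB: "b \<in> B" using T(3) by blast
              then have "x (\<iota> b) = f b mod int (ord b)"
                using b proj q(1) by (simp add: x_def)
              then show "b [^] x (\<iota> b) = b [^] f b"
                using int_pow_mod_ord bB B(1) by auto
            qed (use T(3) B(1) in auto)
            finally show ?thesis .
          qed
          ultimately show "y \<in> \<Phi> ` carrier ?S" by blast
        qed
      qed
    qed
  qed
  then have "?S \<cong> G" unfolding is_iso_def by blast
  then show ?thesis by (rule group.iso_sym[OF grp])
qed

theorem cyclic_decomposition_exists:
  assumes "\<And>x. x \<in> carrier G \<Longrightarrow> x [^] (m::nat) = \<one>" "m > 0"
  shows "\<exists>M n k. cyclic_decomposition G M n k"
proof -
  obtain B where B: "B \<subseteq> carrier G" "power_independent B" "\<forall>b\<in>B. prime_power_order b"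
    "carrier G \<subseteq> power_span B"
    using prime_power_basis[OF subgroup_self assms] by blast
  have "\<forall>b\<in>B. \<exists>r. Factorial_Ring.prime (fst r) \<and> 1 \<le> snd r \<and> ord b = fst r ^ snd r"
    using B(3) unfolding prime_power_order_def by (metis fst_conv snd_conv)
  from bchoice[OF this] obtain r where
    r: "\<And>b. b \<in> B \<Longrightarrow> Factorial_Ring.prime (fst (r b)) \<and> 1 \<le> snd (r b) \<and> ord b = fst (r b) ^ snd (r b)"
    by blast
  define M where "M = (\<lambda>b. fst (r b)) ` B"
  define n where "n p = Max ((\<lambda>b. snd (r b)) ` {b \<in> B. fst (r b) = p})" for p
  define k where "k i p = {b \<in> B. fst (r b) = p \<and> snd (r b) = i}" for i p
  define \<iota> where "\<iota> b = (fst (r b), snd (r b), b)" for b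
  have ord_dvd: "ord b dvd m" if "b \<in> B" for b
    using assms(1) that B(1) pow_eq_id by blast
  have "fst (r b) dvd m" if "b \<in> B" for b
  proof -
    have "fst (r b) dvd ord b" using r[OF that] by (simp add: dvd_power)
    then show ?thesis using ord_dvd[OF that] by (rule dvd_trans)
  qed
  then have "M \<subseteq> {d. d dvd m}" by (auto simp: M_def)
  then have finM: "finite M" using finite_divisors_nat[OF assms(2)] finite_subset by blast
  have "snd (r b) \<le> m" if "b \<in> B" for b
  proof -
    have "1 < fst (r b)" using r[OF that] prime_gt_1_nat by blast
    then have "snd (r b) < ord b" using r[OF that] power_gt_expt by simp
    then show ?thesis using dvd_imp_le[OF ord_dvd[OF that] assms(2)] by linarith
  qed
  then have "(\<lambda>b. snd (r b)) ` {b \<in> B. fst (r b) = p} \<subseteq> {..m}" for p by auto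
  then have fin: "finite ((\<lambda>b. snd (r b)) ` {b \<in> B. fst (r b) = p})" for p
    using finite_subset by blast
  have le_n: "snd (r b) \<le> n (fst (r b))" if "b \<in> B" for b
    unfolding n_def using that by (intro Max_ge[OF fin]) auto
  have attained: "\<exists>b\<in>B. fst (r b) = p \<and> snd (r b) = n p" if "p \<in> M" for p
  proof -
    have "n p \<in> (\<lambda>b. snd (r b)) ` {b \<in> B. fst (r b) = p}"
      unfolding n_def using that by (intro Max_in[OF fin]) (auto simp: M_def)
    then show ?thesis by auto
  qed
  \<comment> \<open>Labelling each basis element by its prime and exponent turns \<open>B\<close> into the required index set.\<close>
  have I: "{(p, i, j). p \<in> M \<and> i \<in> {1..n p} \<and> j \<in> k i p} = \<iota> ` B"
  proof
    show "{(p, i, j). p \<in> M \<and> i \<in> {1..n p} \<and> j \<in> k i p} \<subseteq> \<iota> ` B"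
      by (auto simp: k_def \<iota>_def)
    show "\<iota> ` B \<subseteq> {(p, i, j). p \<in> M \<and> i \<in> {1..n p} \<and> j \<in> k i p}"
      using r le_n by (simp add: image_subset_iff M_def k_def \<iota>_def)
  qed
  have "G \<cong> sum_group (\<iota> ` B) (\<lambda>a. integer_mod_group ((\<lambda>(p, i, j). p ^ i) a))"
  proof (rule sum_group_iso_of_basis[where B = B and \<iota> = \<iota> and proj = "\<lambda>(p, i, j). j" and
      q = "\<lambda>(p, i, j). p ^ i"])
    show "inj_on \<iota> B" by (auto simp: inj_on_def \<iota>_def)
    show "0 < ord b" if "b \<in> B" for b using r[OF that] prime_gt_0_nat[of "fst (r b)"] by simp
  qed (use B r in \<open>auto simp: \<iota>_def\<close>)
  also have "(\<lambda>a. integer_mod_group ((\<lambda>(p, i, j). p ^ i) a)) =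
      (\<lambda>(p::nat, i, j::'a). integer_mod_group (p ^ i))" by auto
  finally have "G \<cong> sum_group {(p, i, j). p \<in> M \<and> i \<in> {1..n p} \<and> j \<in> k i p}
      (\<lambda>(p, i, j). integer_mod_group (p ^ i))" unfolding I .
  moreover have "Factorial_Ring.prime p \<and> 1 \<le> n p \<and> k (n p) p \<noteq> {}" if p: "p \<in> M" for p
  proof -
    obtain b where "b \<in> B" "fst (r b) = p" "snd (r b) = n p" using attained[OF p] by blast
    then show ?thesis using r[of b] by (auto simp: k_def)
  qed
  ultimately have "cyclic_decomposition G M n k"
    using finM unfolding cyclic_decomposition_def by blast
  then show ?thesis by blast
qed

end

section \<open>Group topologies from neighbourhood bases\<close>

locale group_nbhd_base = comm_group G for G (structure) +
  fixes \<B> :: "'a set set"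
  assumes base_nonempty: "\<B> \<noteq> {}"
    and base_subset: "U \<in> \<B> \<Longrightarrow> U \<subseteq> carrier G"
    and base_one: "U \<in> \<B> \<Longrightarrow> \<one> \<in> U"
    and base_Int: "U \<in> \<B> \<Longrightarrow> V \<in> \<B> \<Longrightarrow> \<exists>W\<in>\<B>. W \<subseteq> U \<inter> V"
    and base_mult: "U \<in> \<B> \<Longrightarrow> \<exists>V\<in>\<B>. \<forall>x\<in>V. \<forall>y\<in>V. x \<otimes> y \<in> U"
    and base_inv: "U \<in> \<B> \<Longrightarrow> x \<in> U \<Longrightarrow> inv x \<in> U"
begin

text \<open>The condition \<open>inv x \<otimes> y \<in> U\<close> says that \<open>y\<close> lies in the translate of \<open>U\<close> by \<open>x\<close>.\<close>

definition base_topology :: "'a topology" where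
  "base_topology = topology (\<lambda>S. S \<subseteq> carrier G \<and>
     (\<forall>x\<in>S. \<exists>U\<in>\<B>. \<forall>y\<in>carrier G. inv x \<otimes> y \<in> U \<longrightarrow> y \<in> S))"

lemma openin_base_topology:
  "openin base_topology S \<longleftrightarrow> S \<subseteq> carrier G \<and>
     (\<forall>x\<in>S. \<exists>U\<in>\<B>. \<forall>y\<in>carrier G. inv x \<otimes> y \<in> U \<longrightarrow> y \<in> S)"
proof -
  let ?P = "\<lambda>S. S \<subseteq> carrier G \<and>
     (\<forall>x\<in>S. \<exists>U\<in>\<B>. \<forall>y\<in>carrier G. inv x \<otimes> y \<in> U \<longrightarrow> y \<in> S)"
  have "istopology ?P"
    unfolding istopology_def
  proof (intro conjI allI impI)
    fix S S' assume S: "?P S" and S': "?P S'"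
    show "S \<inter> S' \<subseteq> carrier G" using S by blast
    show "\<forall>x\<in>S \<inter> S'. \<exists>U\<in>\<B>. \<forall>y\<in>carrier G. inv x \<otimes> y \<in> U \<longrightarrow> y \<in> S \<inter> S'"
    proof
      fix x assume x: "x \<in> S \<inter> S'"
      obtain U where U: "U \<in> \<B>" "\<forall>y\<in>carrier G. inv x \<otimes> y \<in> U \<longrightarrow> y \<in> S" using x S by blast
      obtain U' where U': "U' \<in> \<B>" "\<forall>y\<in>carrier G. inv x \<otimes> y \<in> U' \<longrightarrow> y \<in> S'" using x S' by blast
      obtain W where "W \<in> \<B>" "W \<subseteq> U \<inter> U'" using base_Int U U' by blast
      then show "\<exists>U\<in>\<B>. \<forall>y\<in>carrier G. inv x \<otimes> y \<in> U \<longrightarrow> y \<in> S \<inter> S'"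
        using U U' by blast
    qed
  next
    fix K assume "\<forall>S\<in>K. ?P S"
    then show "\<Union>K \<subseteq> carrier G"
      and "\<forall>x\<in>\<Union>K. \<exists>U\<in>\<B>. \<forall>y\<in>carrier G. inv x \<otimes> y \<in> U \<longrightarrow> y \<in> \<Union>K"
      by (blast, meson UnionE UnionI)
  qed
  then show ?thesis unfolding base_topology_def by (simp add: topology_inverse')
qed

lemma topspace_base_topology: "topspace base_topology = carrier G"
proof
  show "topspace base_topology \<subseteq> carrier G"
    using openin_base_topology openin_topspace by blast
  have "openin base_topology (carrier G)"
    using base_nonempty by (auto simp: openin_base_topology)
  then show "carrier G \<subseteq> topspace base_topology" by (rule openin_subset)
qed

text \<open>The members of the base are neighbourhoods but in general not open sets.\<close>

lemma base_translate_interior: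
  assumes "U \<in> \<B>" "x \<in> carrier G"
  obtains S where "openin base_topology S" "x \<in> S" "\<And>y. y \<in> S \<Longrightarrow> inv x \<otimes> y \<in> U"
proof
  let ?S = "{y \<in> carrier G. \<exists>V\<in>\<B>. \<forall>z\<in>carrier G. inv y \<otimes> z \<in> V \<longrightarrow> inv x \<otimes> z \<in> U}"
  show "openin base_topology ?S"
    unfolding openin_base_topology
  proof (intro conjI ballI)
    fix y assume y: "y \<in> ?S"
    then obtain V where V: "V \<in> \<B>" "\<forall>z\<in>carrier G. inv y \<otimes> z \<in> V \<longrightarrow> inv x \<otimes> z \<in> U"
      by blast
    obtain V' where V': "V' \<in> \<B>" "\<forall>a\<in>V'. \<forall>b\<in>V'. a \<otimes> b \<in> V" using base_mult V(1) by blast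
    have "z \<in> ?S" if z: "z \<in> carrier G" "inv y \<otimes> z \<in> V'" for z
    proof -
      have "inv x \<otimes> w \<in> U" if w: "w \<in> carrier G" "inv z \<otimes> w \<in> V'" for w
      proof -
        have "(inv y \<otimes> z) \<otimes> (inv z \<otimes> w) \<in> V" using V' z w by blast
        moreover have "(inv y \<otimes> z) \<otimes> (inv z \<otimes> w) = inv y \<otimes> w"
          using y z w by (simp add: m_assoc) (metis inv_closed m_assoc r_inv l_one)
        ultimately show ?thesis using V w by simp
      qed
      then show ?thesis using z V' by blast
    qed
    then show "\<exists>U\<in>\<B>. \<forall>z\<in>carrier G. inv y \<otimes> z \<in> U \<longrightarrow> z \<in> ?S" using V' by blast
  qed auto
  show "x \<in> ?S" using assms by blast
  show "inv x \<otimes> y \<in> U" if "y \<in> ?S" for y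
    using that base_one by force
qed

lemma group_topology_base: "group_topology G base_topology"
  unfolding group_topology_def
proof (intro conjI)
  show "topspace base_topology = carrier G" by (rule topspace_base_topology)
  show "continuous_map (prod_topology base_topology base_topology) base_topology (\<lambda>(x, y). x \<otimes> y)"
    unfolding continuous_map_def
  proof (intro conjI allI impI)
    fix S assume S: "openin base_topology S"
    let ?P = "{p \<in> topspace (prod_topology base_topology base_topology).
      (case p of (x, y) \<Rightarrow> x \<otimes> y) \<in> S}"
    have "\<exists>X Y. openin base_topology X \<and> openin base_topology Y \<and> x \<in> X \<and> y \<in> Y \<and> X \<times> Y \<subseteq> ?P"
      if "(x, y) \<in> ?P" for x y
    proof -
      have xy: "x \<in> carrier G" "y \<in> carrier G" "x \<otimes> y \<in> S"
        using that by (auto simp: topspace_base_topology)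
      then obtain U where U: "U \<in> \<B>" "\<forall>z\<in>carrier G. inv (x \<otimes> y) \<otimes> z \<in> U \<longrightarrow> z \<in> S"
        using S by (auto simp: openin_base_topology)
      obtain V where V: "V \<in> \<B>" "\<forall>a\<in>V. \<forall>b\<in>V. a \<otimes> b \<in> U" using base_mult U(1) by blast
      obtain X where X: "openin base_topology X" "x \<in> X" "\<And>a. a \<in> X \<Longrightarrow> inv x \<otimes> a \<in> V"
        using base_translate_interior[OF V(1) xy(1)] by metis
      obtain Y where Y: "openin base_topology Y" "y \<in> Y" "\<And>b. b \<in> Y \<Longrightarrow> inv y \<otimes> b \<in> V"
        using base_translate_interior[OF V(1) xy(2)] by metis
      have "a \<otimes> b \<in> S" if ab: "a \<in> X" "b \<in> Y" for a b
      proof -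
        have c: "a \<in> carrier G" "b \<in> carrier G"
          using ab X(1) Y(1) by (auto simp: openin_base_topology)
        have "(inv x \<otimes> a) \<otimes> (inv y \<otimes> b) \<in> U" using V ab X Y by blast
        moreover have "(inv x \<otimes> a) \<otimes> (inv y \<otimes> b) = inv (x \<otimes> y) \<otimes> (a \<otimes> b)"
          using xy c by (simp add: inv_mult m_ac)
        ultimately show ?thesis using U c by simp
      qed
      moreover have "X \<subseteq> carrier G" "Y \<subseteq> carrier G" using X Y by (auto simp: openin_base_topology)
      ultimately have "X \<times> Y \<subseteq> ?P" by (auto simp: topspace_base_topology)
      then show ?thesis using X Y by blast
    qed
    then show "openin (prod_topology base_topology base_topology) ?P"
      unfolding openin_prod_topology_alt by blast
  qed (auto simp: topspace_base_topology)
  show "continuous_map base_topology base_topology (\<lambda>x. inv x)"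
    unfolding continuous_map_def
  proof (intro conjI allI impI)
    fix S assume S: "openin base_topology S"
    have "\<exists>U\<in>\<B>. \<forall>y\<in>carrier G. inv x \<otimes> y \<in> U \<longrightarrow> inv y \<in> S" if x: "x \<in> carrier G" "inv x \<in> S" for x
    proof -
      obtain U where U: "U \<in> \<B>" "\<forall>y\<in>carrier G. inv (inv x) \<otimes> y \<in> U \<longrightarrow> y \<in> S"
        using S x by (auto simp: openin_base_topology)
      have "inv y \<in> S" if y: "y \<in> carrier G" "inv x \<otimes> y \<in> U" for y
      proof -
        have "inv (inv x \<otimes> y) \<in> U" using base_inv U y by blast
        also have "inv (inv x \<otimes> y) = inv (inv x) \<otimes> inv y" using x y by (simp add: inv_mult)
        finally show ?thesis using U y by simp
      qed
      then show ?thesis using U by blast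
    qed
    then show "openin base_topology {x \<in> topspace base_topology. inv x \<in> S}"
      unfolding openin_base_topology by (auto simp: topspace_base_topology)
  qed (auto simp: topspace_base_topology)
qed

lemma Hausdorff_base:
  assumes sep: "\<And>g. g \<in> carrier G \<Longrightarrow> g \<noteq> \<one> \<Longrightarrow> \<exists>U\<in>\<B>. g \<notin> U"
  shows "Hausdorff_space base_topology"
  unfolding Hausdorff_space_def
proof (intro allI impI, elim conjE)
  fix x y assume "x \<in> topspace base_topology" "y \<in> topspace base_topology" and ne: "x \<noteq> y"
  then have xy: "x \<in> carrier G" "y \<in> carrier G" by (auto simp: topspace_base_topology)
  have "inv x \<otimes> y \<noteq> \<one>"
    by (metis ne xy inv_equality inv_inv inv_closed m_comm)
  then obtain U where U: "U \<in> \<B>" "inv x \<otimes> y \<notin> U" using sep xy by blast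
  obtain V where V: "V \<in> \<B>" "\<forall>a\<in>V. \<forall>b\<in>V. a \<otimes> b \<in> U" using base_mult U(1) by blast
  obtain X where X: "openin base_topology X" "x \<in> X" "\<And>a. a \<in> X \<Longrightarrow> inv x \<otimes> a \<in> V"
    using base_translate_interior[OF V(1) xy(1)] by metis
  obtain Y where Y: "openin base_topology Y" "y \<in> Y" "\<And>b. b \<in> Y \<Longrightarrow> inv y \<otimes> b \<in> V"
    using base_translate_interior[OF V(1) xy(2)] by metis
  have False if z: "z \<in> X" "z \<in> Y" for z
  proof -
    have c: "z \<in> carrier G" using z X by (auto simp: openin_base_topology)
    have "(inv x \<otimes> z) \<otimes> inv (inv y \<otimes> z) \<in> U" using V X Y z base_inv by blast
    moreover have "(inv x \<otimes> z) \<otimes> inv (inv y \<otimes> z) = inv x \<otimes> y"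
      using xy c by (simp add: inv_mult m_assoc) (metis inv_closed m_comm m_lcomm r_inv r_one)
    ultimately show False using U by simp
  qed
  then show "\<exists>U V. openin base_topology U \<and> openin base_topology V \<and> x \<in> U \<and> y \<in> V \<and> disjnt U V"
    using X Y unfolding disjnt_def by blast
qed

text \<open>A Cauchy filter converges to each of its cluster points, so it is enough to find one.\<close>

lemma complete_baseI:
  assumes cluster: "\<And>F. group_cauchy_filter G base_topology F \<Longrightarrow>
    \<exists>l\<in>carrier G. \<forall>U\<in>\<B>. frequently (\<lambda>x. x \<in> carrier G \<and> inv l \<otimes> x \<in> U) F"
  shows "complete_group_topology G base_topology"
  unfolding complete_group_topology_def
proof (intro allI impI)
  fix F assume F: "group_cauchy_filter G base_topology F"
  obtain l where l: "l \<in> carrier G"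
    and fr: "\<And>U. U \<in> \<B> \<Longrightarrow> frequently (\<lambda>x. x \<in> carrier G \<and> inv l \<otimes> x \<in> U) F"
    using cluster[OF F] by blast
  have "limitin base_topology (\<lambda>x. x) l F"
    unfolding limitin_def
  proof (intro conjI allI impI, goal_cases)
    case 1 then show ?case using l by (simp add: topspace_base_topology)
  next
    case (2 S)
    then obtain U where U: "U \<in> \<B>" "\<forall>y\<in>carrier G. inv l \<otimes> y \<in> U \<longrightarrow> y \<in> S"
      by (auto simp: openin_base_topology)
    obtain V where V: "V \<in> \<B>" "\<forall>a\<in>V. \<forall>b\<in>V. a \<otimes> b \<in> U" using base_mult U(1) by blast
    obtain W where W: "openin base_topology W" "\<one> \<in> W" "\<And>a. a \<in> W \<Longrightarrow> inv \<one> \<otimes> a \<in> V"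
      using base_translate_interior[OF V(1) one_closed] by metis
    obtain D where D: "D \<subseteq> carrier G" "eventually (\<lambda>x. x \<in> D) F"
      "\<forall>x\<in>D. \<forall>y\<in>D. x \<otimes> inv y \<in> W"
      using F W unfolding group_cauchy_filter_def by blast
    have "frequently (\<lambda>x. (x \<in> carrier G \<and> inv l \<otimes> x \<in> V) \<and> x \<in> D) F"
      using fr[OF V(1)] D(2) by (rule frequently_eventually_frequently)
    then obtain d where d: "d \<in> D" "inv l \<otimes> d \<in> V"
      using frequently_ex by blast
    have "x \<in> S" if x: "x \<in> D" for x
    proof -
      have c: "x \<in> carrier G" "d \<in> carrier G" using x d D by auto
      then have "x \<otimes> inv d \<in> V" using W(3) D(3) x d by fastforce
      then have "(inv l \<otimes> d) \<otimes> (x \<otimes> inv d) \<in> U" using V d by blast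
      moreover have "(inv l \<otimes> d) \<otimes> (x \<otimes> inv d) = inv l \<otimes> x"
        using c l by (simp add: m_assoc) (metis inv_closed m_comm m_lcomm r_inv r_one)
      ultimately show ?thesis using U c by simp
    qed
    then show ?case using D(2) by (rule eventually_mono[rotated])
  qed
  then show "\<exists>l. limitin base_topology (\<lambda>x. x) l F" ..
qed

end

section \<open>The topology of sparse products\<close>

abbreviation to_infinity :: "(nat \<Rightarrow> nat) \<Rightarrow> bool" where
  "to_infinity \<phi> \<equiv> filterlim \<phi> at_top sequentially"

lemma to_infinity_iff: "to_infinity \<phi> \<longleftrightarrow> (\<forall>k. \<exists>N. \<forall>n\<ge>N. k \<le> \<phi> n)"
  by (simp add: filterlim_at_top eventually_sequentially)

lemma finite_family_lower_bound:
  assumes "finite X" "\<And>x. x \<in> X \<Longrightarrow> to_infinity (f x)"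
  shows "\<exists>\<phi>. to_infinity \<phi> \<and> (\<forall>x\<in>X. \<forall>N. \<phi> N \<le> f x N)"
  using assms
proof (induction X rule: finite_induct)
  case empty
  show ?case by (auto intro: exI[of _ id] simp: to_infinity_iff)
next
  case (insert x X)
  then obtain \<phi> where \<phi>: "to_infinity \<phi>" "\<forall>x\<in>X. \<forall>N. \<phi> N \<le> f x N" by auto
  have "to_infinity (\<lambda>N. min (\<phi> N) (f x N))"
    unfolding to_infinity_iff
  proof
    fix k
    obtain N1 N2 where "\<forall>n\<ge>N1. k \<le> \<phi> n" "\<forall>n\<ge>N2. k \<le> f x n"
      using \<phi>(1) insert.prems[of x] unfolding to_infinity_iff by blast
    then show "\<exists>N. \<forall>n\<ge>N. k \<le> min (\<phi> n) (f x n)"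
      by (intro exI[of _ "max N1 N2"]) auto
  qed
  moreover have "\<forall>y\<in>insert x X. \<forall>N. min (\<phi> N) (f x N) \<le> f y N"
    using \<phi>(2) by (auto simp: min.coboundedI1)
  ultimately show ?case by blast
qed

text \<open>The minimum over \<open>n\<close> of \<open>f n N + n\<close>: the added \<open>n\<close> leaves only finitely many of the functions to be
  considered below a given level, so the minimum still tends to infinity.\<close>

lemma diagonal_lower_bound:
  assumes "\<And>n. to_infinity (f n)"
  shows "\<exists>\<phi>. to_infinity \<phi> \<and> (\<forall>n N. \<phi> N \<le> f n N + n)"
proof -
  define \<phi> where "\<phi> N = (LEAST j. \<exists>n. j = f n N + n)" for N
  have "\<exists>n. \<phi> N = f n N + n" for N
    unfolding \<phi>_def by (rule LeastI_ex) blast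
  then obtain h where h: "\<And>N. \<phi> N = f (h N) N + h N" by metis
  have "\<phi> N \<le> f n N + n" for n N
    unfolding \<phi>_def by (rule Least_le) blast
  moreover have "to_infinity \<phi>"
    unfolding to_infinity_iff
  proof
    fix k
    obtain \<psi> where \<psi>: "to_infinity \<psi>" "\<forall>n\<in>{..<k}. \<forall>N. \<psi> N \<le> f n N"
      using finite_family_lower_bound[of "{..<k}" f] assms by auto
    obtain N where "\<forall>n\<ge>N. k \<le> \<psi> n" using \<psi>(1) unfolding to_infinity_iff by blast
    then have "k \<le> \<phi> n" if "n \<ge> N" for n
      using h[of n] \<psi>(2) that by (cases "h n < k") (fastforce intro: le_trans trans_le_add1)+
    then show "\<exists>N. \<forall>n\<ge>N. k \<le> \<phi> n" by blast
  qed
  ultimately show ?thesis by blast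
qed

text \<open>Finiteness of the pieces is what makes the set of products of at most \<open>k\<close> factors behave like a
  compact set: a sequence of factors from the pieces either has a constant subsequence or runs to
  infinity through the pieces.\<close>

locale finite_pieces = comm_group G for G (structure) +
  fixes A :: "nat \<Rightarrow> 'a set"
  assumes piece_subgroup: "subgroup (A n) G"
    and piece_finite: "finite (A n)"
begin

lemma piece_closed: "c \<in> A n \<Longrightarrow> c \<in> carrier G"
  using subgroup.subset[OF piece_subgroup] by blast

lemma piece_one: "\<one> \<in> A n"
  using subgroup.one_closed[OF piece_subgroup] .

definition sections :: "(nat \<Rightarrow> 'a) set" where
  "sections = {x. (\<forall>n. x n \<in> A n) \<and> finite {n. x n \<noteq> \<one>}}"

definition total :: "(nat \<Rightarrow> 'a) \<Rightarrow> 'a" where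
  "total x = gfinprod G x UNIV"

text \<open>With \<open>\<phi>\<close> tending to infinity, these are the neighbourhoods of the identity: the pieces converge to
  the identity, and a product may have many factors only if most of them come late. With
  constant \<open>\<phi>\<close>, they are the products of boundedly many factors. Since \<open>sparse (\<lambda>N. \<phi> N + k)\<close> is the
  product of \<open>sparse (\<lambda>_. k)\<close> and \<open>sparse \<phi>\<close>, such sets also serve as neighbourhoods of
  the set of products of at most \<open>k\<close> factors.\<close>

definition sparse :: "(nat \<Rightarrow> nat) \<Rightarrow> 'a set" where
  "sparse \<phi> = {total x | x. x \<in> sections \<and> (\<forall>N. card {n. n < N \<and> x n \<noteq> \<one>} \<le> \<phi> N)}"

lemma section_closed: "x \<in> sections \<Longrightarrow> x n \<in> carrier G"
  unfolding sections_def using piece_closed by blast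

lemma total_closed: "x \<in> sections \<Longrightarrow> total x \<in> carrier G"
  unfolding total_def by (rule gfinprod_closed) (auto simp: section_closed)

lemma sections_mult:
  assumes "x \<in> sections" "y \<in> sections"
  shows "(\<lambda>n. x n \<otimes> y n) \<in> sections"
proof -
  have "{n. x n \<otimes> y n \<noteq> \<one>} \<subseteq> {n. x n \<noteq> \<one>} \<union> {n. y n \<noteq> \<one>}" by auto
  moreover have "finite ({n. x n \<noteq> \<one>} \<union> {n. y n \<noteq> \<one>})"
    using assms by (simp add: sections_def)
  ultimately have "finite {n. x n \<otimes> y n \<noteq> \<one>}" by (rule finite_subset)
  then show ?thesis
    using assms subgroup.m_closed[OF piece_subgroup] by (simp add: sections_def)
qed

lemma total_mult:
  assumes "x \<in> sections" "y \<in> sections"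
  shows "total (\<lambda>n. x n \<otimes> y n) = total x \<otimes> total y"
  unfolding total_def using assms
  by (intro gfinprod_distrib) (auto simp: section_closed, auto simp: sections_def)

lemma sections_inv:
  assumes "x \<in> sections" shows "(\<lambda>n. inv (x n)) \<in> sections"
proof -
  have "{n. inv (x n) \<noteq> \<one>} = {n. x n \<noteq> \<one>}"
    using section_closed[OF assms] by (simp add: inv_eq_1_iff)
  then show ?thesis
    using assms subgroup.m_inv_closed[OF piece_subgroup] by (simp add: sections_def)
qed

lemma total_inv:
  assumes "x \<in> sections" shows "total (\<lambda>n. inv (x n)) = inv (total x)"
proof -
  have "total (\<lambda>n. inv (x n)) \<otimes> total x = total (\<lambda>n. inv (x n) \<otimes> x n)"
    using assms sections_inv total_mult by simp
  also have "\<dots> = \<one>"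
    using section_closed[OF assms] by (simp add: total_def gfinprod_def)
  finally show ?thesis
    using assms sections_inv total_closed inv_equality by metis
qed

lemma section_single:
  assumes "c \<in> A r"
  shows "(\<lambda>n. if n = r then c else \<one>) \<in> sections" "total (\<lambda>n. if n = r then c else \<one>) = c"
proof -
  have "{n. (if n = r then c else \<one>) \<noteq> \<one>} = (if c = \<one> then {} else {r})" by auto
  then show "(\<lambda>n. if n = r then c else \<one>) \<in> sections"
    using assms piece_one by (simp add: sections_def)
  have "total (\<lambda>n. if n = r then c else \<one>) = gfinprod G (\<lambda>n. c) {r}"
    unfolding total_def
    by (rule gfinprod_mono_neutral_cong_right) (use assms piece_closed in auto)
  then show "total (\<lambda>n. if n = r then c else \<one>) = c"
    using assms piece_closed by simp
qed

lemma total_remove: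
  assumes x: "x \<in> sections"
  shows "(\<lambda>n. if n = r then \<one> else x n) \<in> sections" (is "?y \<in> _")
    and "total x = x r \<otimes> total (\<lambda>n. if n = r then \<one> else x n)"
proof -
  have xr: "x r \<in> A r" using x by (simp add: sections_def)
  have "{n. ?y n \<noteq> \<one>} \<subseteq> {n. x n \<noteq> \<one>}" by auto
  moreover have "finite {n. x n \<noteq> \<one>}" using x by (simp add: sections_def)
  ultimately have "finite {n. ?y n \<noteq> \<one>}" by (rule finite_subset)
  then show y: "?y \<in> sections"
    using x piece_one by (simp add: sections_def)
  have "(\<lambda>n. (if n = r then x r else \<one>) \<otimes> ?y n) = x"
    using section_closed[OF x] by auto
  then show "total x = x r \<otimes> total ?y"
    using total_mult[OF section_single(1)[OF xr] y] section_single(2)[OF xr] by simp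
qed

lemma sparseI:
  assumes "x \<in> sections" "\<And>N. card {n. n < N \<and> x n \<noteq> \<one>} \<le> \<phi> N"
  shows "total x \<in> sparse \<phi>"
  using assms unfolding sparse_def by blast

lemma sparse_subset: "sparse \<phi> \<subseteq> carrier G"
  unfolding sparse_def using total_closed by blast

lemma sparse_mono: "(\<And>N. \<phi> N \<le> \<psi> N) \<Longrightarrow> sparse \<phi> \<subseteq> sparse \<psi>"
  unfolding sparse_def using le_trans by blast

lemma sparse_piece:
  assumes "c \<in> A r" "\<And>N. r < N \<Longrightarrow> 1 \<le> \<phi> N"
  shows "c \<in> sparse \<phi>"
proof -
  have "card {n. n < N \<and> (if n = r then c else \<one>) \<noteq> \<one>} \<le> \<phi> N" for N
  proof (cases "r < N")
    case True
    have "card {n. n < N \<and> (if n = r then c else \<one>) \<noteq> \<one>} \<le> card {r}"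
      by (rule card_mono) auto
    then show ?thesis using assms(2)[OF True] by simp
  next
    case False
    then have "{n. n < N \<and> (if n = r then c else \<one>) \<noteq> \<one>} = {}" by auto
    then show ?thesis by (metis card.empty le0)
  qed
  then have "total (\<lambda>n. if n = r then c else \<one>) \<in> sparse \<phi>"
    by (intro sparseI section_single[OF assms(1)])
  then show ?thesis by (simp only: section_single(2)[OF assms(1)])
qed

lemma sparse_one: "\<one> \<in> sparse \<phi>"
proof -
  have "(\<lambda>n. \<one>) \<in> sections" "total (\<lambda>n. \<one>) = \<one>"
    by (simp_all add: sections_def piece_one total_def gfinprod_def)
  then show ?thesis using sparseI[of "\<lambda>n. \<one>" \<phi>] by simp
qed

lemma sparse_mult:
  assumes "u \<in> sparse \<phi>" "w \<in> sparse \<psi>"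
  shows "u \<otimes> w \<in> sparse (\<lambda>N. \<phi> N + \<psi> N)"
proof -
  obtain x where x: "u = total x" "x \<in> sections" "\<And>N. card {n. n < N \<and> x n \<noteq> \<one>} \<le> \<phi> N"
    using assms(1) unfolding sparse_def by blast
  obtain y where y: "w = total y" "y \<in> sections" "\<And>N. card {n. n < N \<and> y n \<noteq> \<one>} \<le> \<psi> N"
    using assms(2) unfolding sparse_def by blast
  have "card {n. n < N \<and> x n \<otimes> y n \<noteq> \<one>} \<le> \<phi> N + \<psi> N" for N
  proof -
    have "card {n. n < N \<and> x n \<otimes> y n \<noteq> \<one>}
        \<le> card ({n. n < N \<and> x n \<noteq> \<one>} \<union> {n. n < N \<and> y n \<noteq> \<one>})"
      by (rule card_mono) auto
    also have "\<dots> \<le> card {n. n < N \<and> x n \<noteq> \<one>} + card {n. n < N \<and> y n \<noteq> \<one>}"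
      by (rule card_Un_le)
    finally show ?thesis using x(3)[of N] y(3)[of N] by linarith
  qed
  then show ?thesis
    using sparseI[OF sections_mult[OF x(2) y(2)]] total_mult x y by simp
qed

lemma sparse_inv:
  assumes "w \<in> sparse \<phi>" shows "inv w \<in> sparse \<phi>"
proof -
  obtain x where x: "w = total x" "x \<in> sections" "\<And>N. card {n. n < N \<and> x n \<noteq> \<one>} \<le> \<phi> N"
    using assms unfolding sparse_def by blast
  have "{n. n < N \<and> inv (x n) \<noteq> \<one>} = {n. n < N \<and> x n \<noteq> \<one>}" for N
    using section_closed[OF x(2)] by (simp add: inv_eq_1_iff)
  then show ?thesis
    using sparseI[OF sections_inv[OF x(2)], of \<phi>] x total_inv by simp
qed

text \<open>Splits off the first nontrivial factor if it is one of the finitely many candidates before \<open>L\<close>. Only for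
  the first factor does the removal lower the count for every \<open>N\<close> with a nonzero count.\<close>

lemma sparse_first_factor:
  assumes "w \<in> sparse \<phi>"
  shows "(\<exists>r<L. \<exists>c\<in>A r. \<exists>w'\<in>sparse (\<lambda>N. \<phi> N - 1). w = c \<otimes> w') \<or>
    w \<in> sparse (\<lambda>N. if N \<le> L then 0 else \<phi> N)"
proof -
  obtain x where x: "w = total x" "x \<in> sections" "\<And>N. card {n. n < N \<and> x n \<noteq> \<one>} \<le> \<phi> N"
    using assms unfolding sparse_def by blast
  show ?thesis
  proof (cases "\<exists>r<L. x r \<noteq> \<one>")
    case False
    then have "{n. n < N \<and> x n \<noteq> \<one>} = {}" if "N \<le> L" for N using that by auto
    then have "card {n. n < N \<and> x n \<noteq> \<one>} \<le> (if N \<le> L then 0 else \<phi> N)" for N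
      using x(3)[of N] by (cases "N \<le> L") simp_all
    then have "total x \<in> sparse (\<lambda>N. if N \<le> L then 0 else \<phi> N)" by (intro sparseI[OF x(2)])
    then show ?thesis using x(1) by simp
  next
    case True
    define r where "r = (LEAST r. x r \<noteq> \<one>)"
    have r: "x r \<noteq> \<one>" "r < L"
      using True LeastI[of "\<lambda>r. x r \<noteq> \<one>"] Least_le[of "\<lambda>r. x r \<noteq> \<one>"]
      unfolding r_def by (auto intro: le_less_trans)
    have before: "x n = \<one>" if "n < r" for n using that not_less_Least r_def by blast
    let ?y = "\<lambda>n. if n = r then \<one> else x n"
    have xr: "x r \<in> A r" using x(2) by (simp add: sections_def)
    have y: "?y \<in> sections" and w: "w = x r \<otimes> total ?y"
      using total_remove[OF x(2)] x(1) by auto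
    have "card {n. n < N \<and> ?y n \<noteq> \<one>} \<le> \<phi> N - 1" for N
    proof (cases "r < N")
      case True
      have "{n. n < N \<and> ?y n \<noteq> \<one>} = {n. n < N \<and> x n \<noteq> \<one>} - {r}" by auto
      moreover have "r \<in> {n. n < N \<and> x n \<noteq> \<one>}" using True r by simp
      ultimately have "card {n. n < N \<and> ?y n \<noteq> \<one>} = card {n. n < N \<and> x n \<noteq> \<one>} - 1"
        by (simp only: card_Diff_singleton)
      then show ?thesis using x(3)[of N] by linarith
    next
      case False
      then have "{n. n < N \<and> ?y n \<noteq> \<one>} = {}" using before by auto
      then show ?thesis by (simp only: card.empty le0)
    qed
    then have "total ?y \<in> sparse (\<lambda>N. \<phi> N - 1)" by (intro sparseI[OF y])
    then show ?thesis using w r xr by blast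
  qed
qed

definition sparse_base :: "'a set set" where
  "sparse_base = {sparse \<phi> | \<phi>. to_infinity \<phi>}"

lemma half_to_infinity: "to_infinity \<phi> \<Longrightarrow> to_infinity (\<lambda>N. \<phi> N div 2)"
  unfolding to_infinity_iff
proof
  fix k assume "\<forall>k. \<exists>N. \<forall>n\<ge>N. k \<le> \<phi> n"
  then obtain N where "\<forall>n\<ge>N. 2 * k \<le> \<phi> n" by blast
  then have "\<forall>n\<ge>N. k \<le> \<phi> n div 2" by auto
  then show "\<exists>N. \<forall>n\<ge>N. k \<le> \<phi> n div 2" ..
qed

sublocale group_nbhd_base G sparse_base
proof
  show "sparse_base \<noteq> {}"
    unfolding sparse_base_def using filterlim_ident by blast
  show "U \<subseteq> carrier G" if "U \<in> sparse_base" for U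
    using that sparse_subset by (auto simp: sparse_base_def)
  show "\<one> \<in> U" if "U \<in> sparse_base" for U
    using that sparse_one by (auto simp: sparse_base_def)
  show "inv x \<in> U" if "U \<in> sparse_base" "x \<in> U" for U x
    using that sparse_inv by (auto simp: sparse_base_def)
  show "\<exists>W\<in>sparse_base. W \<subseteq> U \<inter> V" if UV: "U \<in> sparse_base" "V \<in> sparse_base" for U V
  proof -
    obtain \<phi> \<psi> where "to_infinity \<phi>" "to_infinity \<psi>" "U = sparse \<phi>" "V = sparse \<psi>"
      using UV unfolding sparse_base_def by blast
    moreover obtain \<theta> where "to_infinity \<theta>" "\<forall>x\<in>{\<phi>, \<psi>}. \<forall>N. \<theta> N \<le> x N"
      using finite_family_lower_bound[of "{\<phi>, \<psi>}" id] calculation by auto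
    ultimately have "sparse \<theta> \<in> sparse_base" "sparse \<theta> \<subseteq> U \<inter> V"
      using sparse_mono by (auto simp: sparse_base_def) 
    then show ?thesis by blast
  qed
  show "\<exists>V\<in>sparse_base. \<forall>x\<in>V. \<forall>y\<in>V. x \<otimes> y \<in> U" if U: "U \<in> sparse_base" for U
  proof -
    obtain \<phi> where \<phi>: "to_infinity \<phi>" "U = sparse \<phi>"
      using U unfolding sparse_base_def by blast
    let ?\<psi> = "\<lambda>N. \<phi> N div 2"
    have "?\<psi> N + ?\<psi> N \<le> \<phi> N" for N by simp
    from sparse_mono[of "\<lambda>N. ?\<psi> N + ?\<psi> N" \<phi>, OF this]
    have "x \<otimes> y \<in> U" if "x \<in> sparse ?\<psi>" "y \<in> sparse ?\<psi>" for x y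
      using sparse_mult[OF that] \<phi>(2) by blast
    then show ?thesis using half_to_infinity[OF \<phi>(1)] by (auto simp: sparse_base_def)
  qed
qed

text \<open>Compactness of the set of products of at most \<open>k\<close> factors, in the form that is used: a filter
  that avoids a neighbourhood of each point avoids a neighbourhood of the translate of this set by \<open>y\<close>.
  The induction on \<open>k\<close> moves the first factor \<open>c\<close> into the base point. If \<open>c\<close> comes early, there are only
  finitely many possibilities and the induction hypothesis applies at \<open>y \<otimes> c\<close>; if it comes late, it
  already belongs to the neighbourhood found for \<open>k\<close> at \<open>y\<close>.\<close>

lemma no_cluster_avoids:
  assumes nc: "\<And>l. l \<in> carrier G \<Longrightarrow>
      \<exists>\<phi>. to_infinity \<phi> \<and> eventually (\<lambda>x. x \<in> carrier G \<longrightarrow> inv l \<otimes> x \<notin> sparse \<phi>) F"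
    and y: "y \<in> carrier G"
  shows "\<exists>\<phi>. to_infinity \<phi> \<and>
    eventually (\<lambda>x. x \<in> carrier G \<longrightarrow> inv y \<otimes> x \<notin> sparse (\<lambda>N. \<phi> N + k)) F"
  using y
proof (induction k arbitrary: y)
  case 0
  then show ?case using nc by simp
next
  case (Suc k)
  obtain \<phi>0 where \<phi>0: "to_infinity \<phi>0"
    "eventually (\<lambda>x. x \<in> carrier G \<longrightarrow> inv y \<otimes> x \<notin> sparse (\<lambda>N. \<phi>0 N + k)) F"
    using Suc by blast
  obtain L where L: "\<And>N. L \<le> N \<Longrightarrow> 1 \<le> \<phi>0 N" using \<phi>0(1) unfolding to_infinity_iff by blast
  define C where "C = (\<Union>r<L. A r)"
  have finC: "finite C" unfolding C_def using piece_finite by blast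
  have "\<forall>c\<in>C. \<exists>\<phi>. to_infinity \<phi> \<and>
      eventually (\<lambda>x. x \<in> carrier G \<longrightarrow> inv (y \<otimes> c) \<otimes> x \<notin> sparse (\<lambda>N. \<phi> N + k)) F"
    using Suc piece_closed unfolding C_def by blast
  from bchoice[OF this] obtain f where f: "\<And>c. c \<in> C \<Longrightarrow> to_infinity (f c)"
    "\<And>c. c \<in> C \<Longrightarrow>
      eventually (\<lambda>x. x \<in> carrier G \<longrightarrow> inv (y \<otimes> c) \<otimes> x \<notin> sparse (\<lambda>N. f c N + k)) F"
    by blast
  \<comment> \<open>One unit of \<open>\<phi>0\<close> is reserved for a late first factor.\<close>
  have pred: "to_infinity (\<lambda>N. \<phi>0 N - 1)"
    unfolding to_infinity_iff
  proof
    fix j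
    obtain N where "\<forall>n\<ge>N. Suc j \<le> \<phi>0 n" using \<phi>0(1) unfolding to_infinity_iff by blast
    then show "\<exists>N. \<forall>n\<ge>N. j \<le> \<phi>0 n - 1" by fastforce
  qed
  obtain \<phi>1 where \<phi>1: "to_infinity \<phi>1" "\<forall>c\<in>C. \<forall>N. \<phi>1 N \<le> f c N"
    using finite_family_lower_bound[of C f] finC f(1) by blast
  obtain \<phi> where \<phi>: "to_infinity \<phi>" "\<And>N. \<phi> N \<le> \<phi>1 N" "\<And>N. \<phi> N \<le> \<phi>0 N - 1"
    using finite_family_lower_bound[of "{\<phi>1, \<lambda>N. \<phi>0 N - 1}" id] \<phi>1(1) pred by auto
  have "eventually (\<lambda>x. \<forall>c\<in>C. x \<in> carrier G \<longrightarrow>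
      inv (y \<otimes> c) \<otimes> x \<notin> sparse (\<lambda>N. f c N + k)) F"
    using f(2) by (intro eventually_ball_finite[OF finC]) blast
  with \<phi>0(2) have "eventually (\<lambda>x. x \<in> carrier G \<longrightarrow>
      inv y \<otimes> x \<notin> sparse (\<lambda>N. \<phi> N + Suc k)) F"
  proof eventually_elim
    case (elim x)
    show ?case
    proof (intro impI notI)
      assume xG: "x \<in> carrier G" and "inv y \<otimes> x \<in> sparse (\<lambda>N. \<phi> N + Suc k)"
      from sparse_first_factor[OF this(2), of L]
      consider (early) r c w where "r < L" "c \<in> A r" "w \<in> sparse (\<lambda>N. \<phi> N + k)"
          "inv y \<otimes> x = c \<otimes> w"
        | (late) "inv y \<otimes> x \<in> sparse (\<lambda>N. if N \<le> L then 0 else \<phi> N + Suc k)"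
        unfolding add_Suc_right diff_Suc_1 by blast
      then show False
      proof cases
        case early
        then have c: "c \<in> C" "c \<in> carrier G" and w: "w \<in> carrier G"
          using piece_closed sparse_subset unfolding C_def by blast+
        have "inv (y \<otimes> c) \<otimes> x = inv c \<otimes> (inv y \<otimes> x)"
          using Suc.prems c xG by (simp add: inv_mult_group m_assoc)
        also have "\<dots> = w"
          unfolding early(4) using c w by (metis inv_closed m_assoc l_inv l_one)
        also have "sparse (\<lambda>N. \<phi> N + k) \<subseteq> sparse (\<lambda>N. f c N + k)"
          using \<phi>(2) \<phi>1(2) c by (intro sparse_mono) (meson add_le_mono1 le_trans)
        ultimately show False using elim(2) c xG early(3) by auto
      next
        case late
        have "sparse (\<lambda>N. if N \<le> L then 0 else \<phi> N + Suc k) \<subseteq> sparse (\<lambda>N. \<phi>0 N + k)"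
        proof (rule sparse_mono)
          show "(if N \<le> L then 0 else \<phi> N + Suc k) \<le> \<phi>0 N + k" for N
            using L[of N] \<phi>(3)[of N] by auto
        qed
        then show False using late elim(1) xG by blast
      qed
    qed
  qed
  then show ?case using \<phi>(1) by blast
qed

text \<open>If there were no cluster point, the filter would avoid some \<open>sparse (\<lambda>N. f k N + 2 * k)\<close> for every \<open>k\<close>.
  The functions \<open>f k\<close> combine into one \<open>\<phi>\<close> with \<open>\<phi> N \<le> f k N + k\<close>, and the filter has a member \<open>D\<close>
  that is small of order \<open>sparse \<phi>\<close>. If \<open>d \<in> D\<close> is a product of \<open>k\<close> factors, \<open>D\<close> is contained in
  \<open>sparse (\<lambda>N. k + \<phi> N)\<close>, which lies in one of the avoided sets. The doubled \<open>k\<close> pays both for \<open>d\<close> and for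
  the loss in the diagonal bound.\<close>

lemma complete_sparse:
  assumes gen: "\<And>g. g \<in> carrier G \<Longrightarrow> \<exists>k. g \<in> sparse (\<lambda>_. k)"
  shows "complete_group_topology G base_topology"
proof (rule complete_baseI, rule ccontr)
  fix F assume F: "group_cauchy_filter G base_topology F"
    and no: "\<not> (\<exists>l\<in>carrier G. \<forall>U\<in>sparse_base. frequently (\<lambda>x. x \<in> carrier G \<and> inv l \<otimes> x \<in> U) F)"
  have nc: "\<exists>\<phi>. to_infinity \<phi> \<and> eventually (\<lambda>x. x \<in> carrier G \<longrightarrow> inv l \<otimes> x \<notin> sparse \<phi>) F"
    if "l \<in> carrier G" for l
    using no that unfolding sparse_base_def frequently_def by auto
  have "\<exists>\<phi>. to_infinity \<phi> \<and>
      eventually (\<lambda>x. x \<in> carrier G \<longrightarrow> inv \<one> \<otimes> x \<notin> sparse (\<lambda>N. \<phi> N + (k + k))) F" for k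
    using no_cluster_avoids[OF nc one_closed] by blast
  then have "\<forall>k. \<exists>\<phi>. to_infinity \<phi> \<and>
      eventually (\<lambda>x. x \<in> carrier G \<longrightarrow> inv \<one> \<otimes> x \<notin> sparse (\<lambda>N. \<phi> N + (k + k))) F"
    by blast
  from choice[OF this] obtain f where f: "\<And>k. to_infinity (f k)"
    "\<And>k. eventually (\<lambda>x. x \<in> carrier G \<longrightarrow> inv \<one> \<otimes> x \<notin> sparse (\<lambda>N. f k N + (k + k))) F"
    by blast
  obtain \<phi> where \<phi>: "to_infinity \<phi>" "\<forall>n N. \<phi> N \<le> f n N + n"
    using diagonal_lower_bound[of f] f(1) by blast
  have "sparse \<phi> \<in> sparse_base" using \<phi> by (auto simp: sparse_base_def)
  then obtain W where W: "openin base_topology W" "\<one> \<in> W" "\<And>a. a \<in> W \<Longrightarrow> inv \<one> \<otimes> a \<in> sparse \<phi>"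
    using base_translate_interior one_closed by metis
  obtain D where D: "D \<subseteq> carrier G" "eventually (\<lambda>x. x \<in> D) F"
    "\<forall>x\<in>D. \<forall>y\<in>D. x \<otimes> inv y \<in> W"
    using F W unfolding group_cauchy_filter_def by blast
  have nonbot: "F \<noteq> bot" using F by (simp add: group_cauchy_filter_def)
  obtain d where d: "d \<in> D" using D(2) nonbot eventually_happens by blast
  then have dG: "d \<in> carrier G" using D by blast
  obtain k where k: "d \<in> sparse (\<lambda>_. k)" using gen[OF dG] by blast
  have "eventually (\<lambda>x. False) F"
    using D(2) f(2)[of k]
  proof eventually_elim
    case (elim x)
    have xG: "x \<in> carrier G" using elim D by blast
    have "x \<otimes> inv d \<in> sparse \<phi>" using W(3) D(3) elim d xG dG by fastforce
    then have "d \<otimes> (x \<otimes> inv d) \<in> sparse (\<lambda>N. k + \<phi> N)" using sparse_mult[OF k] by blast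
    moreover have "d \<otimes> (x \<otimes> inv d) = x"
      using xG dG by (metis inv_closed m_assoc m_comm r_inv r_one)
    moreover have "sparse (\<lambda>N. k + \<phi> N) \<subseteq> sparse (\<lambda>N. f k N + (k + k))"
      using \<phi>(2) by (intro sparse_mono) (simp add: ac_simps)
    ultimately show False using elim(2) xG by auto
  qed
  then show False using nonbot by (simp add: eventually_False)
qed

end

section \<open>Minimally almost periodic topologies from independent sequences\<close>

lemma group_circle_group: "group circle_group"
proof (rule groupI)
  fix x assume x: "x \<in> carrier circle_group"
  then have "x \<noteq> 0" by (auto simp: circle_group_def)
  with x have "inverse x \<in> carrier circle_group" "inverse x \<otimes>\<^bsub>circle_group\<^esub> x = \<one>\<^bsub>circle_group\<^esub>"
    by (auto simp: circle_group_def norm_inverse)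
  then show "\<exists>y\<in>carrier circle_group. y \<otimes>\<^bsub>circle_group\<^esub> x = \<one>\<^bsub>circle_group\<^esub>" ..
qed (auto simp: circle_group_def norm_mult)

lemma circle_group_pow: "z [^]\<^bsub>circle_group\<^esub> (n::nat) = z ^ n"
  by (induction n) (simp_all add: circle_group_def mult.commute)

lemma (in finite_pieces) total_in_subgroup:
  assumes "subgroup K G" "\<And>n. x n \<in> K"
  shows "total x \<in> K"
  unfolding total_def by (rule gfinprod_in_subgroup[OF assms(1)]) (rule assms(2))

text \<open>Used to read off a single coordinate of a product, with \<open>K\<close> the subgroup on which that coordinate
  vanishes.\<close>

lemma (in finite_pieces) exceptional_factor_in_subgroup:
  assumes K: "subgroup K G" and x: "x \<in> sections" and tot: "total x \<in> K"
    and other: "\<And>n. n \<noteq> r \<Longrightarrow> x n \<in> K"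
  shows "x r \<in> K"
proof -
  have "total (\<lambda>n. if n = r then \<one> else x n) \<in> K"
    using total_in_subgroup[OF K] other subgroup.one_closed[OF K] by simp
  then show ?thesis
    using subgroup_mult_cancel[OF K, of "x r"] tot section_closed[OF x]
    unfolding total_remove(2)[OF x, of r] by blast
qed

lemma (in finite_pieces) sparse_finprod:
  assumes "finite S" "\<And>i. i \<in> S \<Longrightarrow> f i \<in> A (h i)"
  shows "finprod G f S \<in> sparse (\<lambda>_. card S)"
  using assms
proof (induction S rule: finite_induct)
  case (insert i S)
  have cl: "f \<in> S \<rightarrow> carrier G" "f i \<in> carrier G"
    using insert.prems piece_closed by auto
  have "f i \<in> sparse (\<lambda>_. 1)" using insert.prems by (intro sparse_piece) auto
  then have "f i \<otimes> finprod G f S \<in> sparse (\<lambda>_. 1 + card S)"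
    by (rule sparse_mult) (use insert in auto)
  then show ?case using insert.hyps cl by simp
qed (simp add: sparse_one)

text \<open>The subgroup \<open>K t\<close> plays the role of the elements whose coordinates at \<open>e t\<close> vanish: \<open>e i\<close> has no
  coordinates at \<open>e t\<close> for \<open>i \<noteq> t\<close>, and every element has nonzero coordinates at only finitely many \<open>e t\<close>.
  The last assumption combines that \<open>e t\<close> has the largest possible order and that no nontrivial power
  of it lies in \<open>K t\<close>.\<close>

locale independent_sequence = comm_group G for G (structure) +
  fixes m :: nat and e :: "nat \<Rightarrow> 'a" and K :: "nat \<Rightarrow> 'a set"
  assumes countable: "countable (carrier G)"
    and m_pos: "m > 0" and exponent: "x \<in> carrier G \<Longrightarrow> x [^] m = \<one>"
    and e_closed: "e t \<in> carrier G"
    and K_subgroup: "subgroup (K t) G"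
    and e_other: "i \<noteq> t \<Longrightarrow> e i \<in> K t"
    and almost_all: "x \<in> carrier G \<Longrightarrow> finite {t. x \<notin> K t}"
    and e_power: "e t [^] (c::int) \<in> K t \<Longrightarrow> x \<in> carrier G \<Longrightarrow> x [^] c = \<one>"
begin

text \<open>Every element of \<open>G\<close> is listed infinitely often; the second component of the decoded pair is a
  dummy.\<close>

definition listing :: "nat \<Rightarrow> 'a" where
  "listing n = from_nat_into (carrier G) (fst (prod_decode n))"

lemma listing_closed: "listing n \<in> carrier G"
  unfolding listing_def by (rule from_nat_into) auto

lemma listing_infinitely_often:
  assumes "x \<in> carrier G" obtains n where "n \<ge> k" "listing n = x"
proof
  show "prod_encode (to_nat_on (carrier G) x, k) \<ge> k" by (rule le_prod_encode_2)
  show "listing (prod_encode (to_nat_on (carrier G) x, k)) = x"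
    using assms countable by (simp add: listing_def)
qed

definition bound :: "'a \<Rightarrow> nat" where
  "bound x = (SOME b. \<forall>t\<ge>b. x \<in> K t)"

lemma in_K_beyond_bound:
  assumes "x \<in> carrier G" "t \<ge> bound x"
  shows "x \<in> K t"
proof -
  obtain b where "\<forall>t\<in>{t. x \<notin> K t}. t < b"
    using almost_all[OF assms(1)] finite_nat_set_iff_bounded by blast
  then have "\<exists>b. \<forall>t\<ge>b. x \<in> K t" by (meson mem_Collect_eq not_less)
  from someI_ex[OF this] show ?thesis using assms(2) unfolding bound_def by blast
qed

text \<open>The block \<open>{start n..<start n + n + 1}\<close> must lie after all earlier blocks and beyond the bounds of
  \<open>listing 0, \<dots>, listing n\<close>; a sum achieves both.\<close>

definition start :: "nat \<Rightarrow> nat" where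
  "start n = (\<Sum>i\<le>n. bound (listing i) + i + 1)"

definition block :: "nat \<Rightarrow> nat set" where
  "block n = {start n..<start n + n + 1}"

lemma start_after_block: "i < n \<Longrightarrow> start i + i + 1 \<le> start n"
proof (induction n)
  case (Suc n)
  have "start (Suc n) = start n + (bound (listing (Suc n)) + Suc n + 1)" by (simp add: start_def)
  then show ?case using Suc by (cases "i = n") auto
qed simp

lemma start_ge: "n \<le> start n"
  unfolding start_def by (cases n) auto

lemma listing_in_K: assumes "i \<le> n" "start n \<le> t" shows "listing i \<in> K t"
proof -
  have "bound (listing i) + i + 1 \<le> start n"
    unfolding start_def using assms(1) by (intro member_le_sum) auto
  then show ?thesis using in_K_beyond_bound listing_closed assms(2) by simp
qed

text \<open>The block makes the listed element expensive: recovering \<open>listing n\<close> from \<open>twisted n\<close> takes \<open>n + 1\<close>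
  further factors. So \<open>twisted n\<close> can converge to the identity although \<open>listing n\<close> does not.\<close>

definition twisted :: "nat \<Rightarrow> 'a" where
  "twisted n = listing n \<otimes> finprod G e (block n)"

definition generator :: "nat \<Rightarrow> 'a" where
  "generator r = (if even r then e (r div 2) else twisted (r div 2))"

definition piece :: "nat \<Rightarrow> 'a set" where
  "piece r = range (\<lambda>c::int. generator r [^] c)"

lemma twisted_closed: "twisted n \<in> carrier G"
  unfolding twisted_def using listing_closed e_closed by (simp add: Pi_def)

lemma generator_closed: "generator r \<in> carrier G"
  unfolding generator_def using e_closed twisted_closed by simp

sublocale finite_pieces G piece
proof (intro finite_pieces.intro finite_pieces_axioms.intro)
  show "comm_group G" by (rule comm_group_axioms)
  fix r
  have "piece r = generate G {generator r}"
    unfolding piece_def using generate_pow[OF generator_closed] by auto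
  then show "subgroup (piece r) G" using generate_is_subgroup generator_closed by simp
  show "finite (piece r)"
    unfolding piece_def using finite_cyclic_powers generator_closed exponent m_pos by blast
qed

lemma generator_in_piece: "generator r \<in> piece r"
  unfolding piece_def using int_pow_1[OF generator_closed] by (metis rangeI)

lemma e_in_piece: "e t \<in> piece (2 * t)"
  using generator_in_piece[of "2 * t"] by (simp add: generator_def)

lemma twisted_in_piece: "twisted n \<in> piece (2 * n + 1)"
  using generator_in_piece[of "2 * n + 1"] by (simp add: generator_def)

lemma listing_eq: "listing n = twisted n \<otimes> inv (finprod G e (block n))"
  unfolding twisted_def using listing_closed e_closed by (simp add: Pi_def m_assoc)

lemma boundedly_sparse:
  assumes "x \<in> carrier G" shows "\<exists>k. x \<in> sparse (\<lambda>_. k)"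
proof -
  obtain n where n: "listing n = x" using listing_infinitely_often[OF assms] by blast
  have "finprod G e (block n) \<in> sparse (\<lambda>_. card (block n))"
    by (rule sparse_finprod[where h = "\<lambda>t. 2 * t"]) (auto simp: block_def e_in_piece)
  then have "inv (finprod G e (block n)) \<in> sparse (\<lambda>_. card (block n))" by (rule sparse_inv)
  moreover have "twisted n \<in> sparse (\<lambda>_. 1)" by (rule sparse_piece[OF twisted_in_piece]) simp
  ultimately have "x \<in> sparse (\<lambda>_. 1 + card (block n))"
    using sparse_mult listing_eq n by fastforce
  then show ?thesis by blast
qed

text \<open>A continuous character maps some \<open>sparse \<phi>\<close> to roots of unity near 1, hence to 1. So it is trivial on
  all late pieces, and these generate \<open>G\<close>, since every element is listed at arbitrarily late positions.\<close>

lemma character_trivial: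
  assumes \<gamma>: "\<gamma> \<in> continuous_characters G base_topology" and y: "y \<in> carrier G"
  shows "\<gamma> y = 1"
proof -
  have hom: "\<gamma> \<in> hom G circle_group"
    and cont: "continuous_map base_topology (top_of_set (sphere 0 1)) \<gamma>"
    using \<gamma> by (auto simp: continuous_characters_def circle_group_def)
  interpret \<gamma>: group_hom G circle_group \<gamma>
    using hom group_circle_group by (simp add: group_hom_def group_hom_axioms_def is_group)
  \<comment> \<open>The roots of unity that a continuous character has to avoid near the identity.\<close>
  define R where "R = {z::complex. z ^ m = 1 \<and> z \<noteq> 1}"
  have "finite R"
    unfolding R_def using finite_roots_unity[of m] m_pos by (auto intro: finite_subset[rotated])
  then have "closed R" by (rule finite_imp_closed)
  then have "openin (top_of_set (sphere 0 1)) (sphere 0 1 - R)"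
    by (simp add: Diff_eq open_Compl openin_open_Int)
  then have op: "openin base_topology {x \<in> carrier G. \<gamma> x \<in> sphere 0 1 - R}"
    using cont unfolding continuous_map_def topspace_base_topology by blast
  have one: "\<gamma> \<one> = 1" using \<gamma>.hom_one by (simp add: circle_group_def)
  then have "\<one> \<in> {x \<in> carrier G. \<gamma> x \<in> sphere 0 1 - R}" by (simp add: R_def)
  then obtain U where "U \<in> sparse_base"
    "\<forall>x\<in>carrier G. inv \<one> \<otimes> x \<in> U \<longrightarrow> x \<in> {x \<in> carrier G. \<gamma> x \<in> sphere 0 1 - R}"
    using op unfolding openin_base_topology by blast
  then obtain \<phi> where \<phi>: "to_infinity \<phi>" "\<And>x. x \<in> sparse \<phi> \<Longrightarrow> \<gamma> x \<notin> R"
    unfolding sparse_base_def using sparse_subset by fastforce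
  have triv: "\<gamma> x = 1" if "x \<in> sparse \<phi>" for x
  proof -
    have x: "x \<in> carrier G" using that sparse_subset by blast
    have "\<gamma> x ^ m = 1"
      using \<gamma>.hom_nat_pow[OF x, of m] exponent[OF x] one by (simp add: circle_group_pow)
    then show ?thesis using \<phi>(2)[OF that] by (simp add: R_def)
  qed
  obtain L where L: "\<And>N. L \<le> N \<Longrightarrow> 1 \<le> \<phi> N"
    using \<phi>(1) unfolding to_infinity_iff by blast
  have late: "\<gamma> x = 1" if "x \<in> piece r" "L \<le> r" for x r
    using triv sparse_piece[OF that(1)] L that(2) by simp
  have ker: "subgroup (kernel G circle_group \<gamma>) G" by (rule \<gamma>.subgroup_kernel)
  obtain n where n: "n \<ge> L" "listing n = y" using listing_infinitely_often[OF y] by blast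
  have "e t \<in> kernel G circle_group \<gamma>" if "t \<in> block n" for t
    using that late[OF e_in_piece] n(1) start_ge[of n] e_closed
    by (auto simp: block_def kernel_def circle_group_def)
  then have "finprod G e (block n) \<in> kernel G circle_group \<gamma>"
    by (intro finprod_in_subgroup[OF ker]) (auto simp: block_def)
  moreover have "twisted n \<in> kernel G circle_group \<gamma>"
    using late[OF twisted_in_piece] n(1) twisted_closed by (simp add: kernel_def circle_group_def)
  ultimately have "y \<in> kernel G circle_group \<gamma>"
    unfolding n(2)[symmetric] listing_eq
    using subgroup.m_closed[OF ker] subgroup.m_inv_closed[OF ker] by blast
  then show ?thesis by (simp add: kernel_def circle_group_def)
qed

text \<open>Below the end of block \<open>n\<close>, at most \<open>n\<close> nontrivial factors are permitted, one less than the block has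
  elements. The factor 2 comes from interleaving the elements \<open>e t\<close> with the twisted ones.\<close>

definition slow :: "nat \<Rightarrow> nat" where
  "slow N = (LEAST n. N \<le> 2 * (start n + n + 1))"

lemma slow_le: "slow (2 * (start n + n + 1)) \<le> n"
  unfolding slow_def by (rule Least_le) simp

lemma slow_to_infinity: "to_infinity slow"
  unfolding to_infinity_iff
proof
  fix k
  have "k \<le> slow N" if N: "N \<ge> 2 * (start k + k + 1)" for N
  proof (rule ccontr)
    assume less: "\<not> k \<le> slow N"
    have "N \<le> 2 * (start N + N + 1)" by simp
    then have "N \<le> 2 * (start (slow N) + slow N + 1)" unfolding slow_def by (rule LeastI)
    moreover have "start (slow N) + slow N + 1 \<le> start k" using start_after_block less by simp
    ultimately have "N \<le> 2 * start k" by (meson le_trans mult_le_mono2)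
    then show False using N by simp
  qed
  then show "\<exists>N. \<forall>n\<ge>N. k \<le> slow n" by blast
qed

text \<open>Let \<open>y \<noteq> 1\<close> be listed at \<open>i\<close>, and forbid all factors up to \<open>e (start i)\<close> and \<open>twisted (start i)\<close>.
  By the choice of \<open>start\<close>, \<open>y\<close> has no coordinates at any later \<open>e t\<close>. Suppose that \<open>y\<close> is a
  sparse product. If it has a twisted factor, let \<open>n\<close> be the last index of such a factor. At \<open>t \<in> block n\<close>, the only factors with coordinates are
  the power of \<open>twisted n\<close> and the power of \<open>e t\<close>, so the latter cannot be trivial. This gives \<open>n + 1\<close>
  factors where at most \<open>n\<close> are permitted. If there is no twisted factor, the coordinate at
  any \<open>e t\<close> that occurs shows that its power is trivial.\<close>

lemma separated:
  assumes y: "y \<in> carrier G" "y \<noteq> \<one>"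
  shows "\<exists>U\<in>sparse_base. y \<notin> U"
proof -
  obtain i where i: "listing i = y" using listing_infinitely_often[OF y(1)] by blast
  define \<phi> where "\<phi> N = (if N \<le> 2 * start i + 2 then 0 else slow N)" for N
  have "to_infinity \<phi>"
    unfolding to_infinity_iff
  proof
    fix k
    obtain N where "\<forall>n\<ge>N. k \<le> slow n" using slow_to_infinity unfolding to_infinity_iff by blast
    then have "\<forall>n\<ge>N + 2 * start i + 3. k \<le> \<phi> n" by (simp add: \<phi>_def)
    then show "\<exists>N. \<forall>n\<ge>N. k \<le> \<phi> n" by blast
  qed
  moreover have "y \<notin> sparse \<phi>"
  proof
    assume "y \<in> sparse \<phi>"
    then obtain x where x: "y = total x" "x \<in> sections"
      and few: "\<And>N. card {n. n < N \<and> x n \<noteq> \<one>} \<le> \<phi> N"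
      unfolding sparse_def by blast
    have late: "r > 2 * start i + 1" if "x r \<noteq> \<one>" for r
    proof (rule ccontr)
      assume "\<not> r > 2 * start i + 1"
      then have "\<phi> (Suc r) = 0" by (simp add: \<phi>_def)
      then have "{n. n < Suc r \<and> x n \<noteq> \<one>} = {}" using few[of "Suc r"] by simp
      then show False using that by blast
    qed
    have y_in: "y \<in> K t" if "start i \<le> t" for t using listing_in_K[of i i t] that i by simp
    have x_piece: "\<exists>c::int. x r = generator r [^] c" for r
      using x(2) unfolding sections_def piece_def by blast
    have even_in: "x (2 * s) \<in> K t" if "s \<noteq> t" for s t
    proof -
      obtain c :: int where "x (2 * s) = e s [^] c"
        using x_piece[of "2 * s"] by (auto simp: generator_def)
      then show ?thesis using subgroup_int_pow_closed[OF K_subgroup e_other] that by simp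
    qed
    show False
    proof (cases "\<exists>n. x (2 * n + 1) \<noteq> \<one>")
      case True
      have "finite ((\<lambda>n. 2 * n + 1) -` {r. x r \<noteq> \<one>})"
        using x(2) by (intro finite_vimageI) (auto simp: sections_def inj_on_def)
      then have fin: "finite {n. x (2 * n + 1) \<noteq> \<one>}" by (simp add: vimage_def)
      define n where "n = Max {n. x (2 * n + 1) \<noteq> \<one>}"
      have n: "x (2 * n + 1) \<noteq> \<one>"
        using Max_in[OF fin] True unfolding n_def by blast
      have after: "x (2 * k + 1) = \<one>" if "n < k" for k
        using Max_ge[OF fin, of k] that unfolding n_def by fastforce
      have "n \<ge> i" using late[OF n] start_ge[of i] by linarith
      have "x (2 * t) \<noteq> \<one>" if t: "t \<in> block n" for t
      proof
        \<comment> \<open>Then the power of \<open>twisted n\<close> is the only factor that could have coordinates at \<open>e t\<close>.\<close>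
        assume xt: "x (2 * t) = \<one>"
        have tn: "start n \<le> t" using t by (simp add: block_def)
        have below: "twisted k \<in> K t" if "k < n" for k
        proof -
          have "t \<notin> block k" using start_after_block[OF that] tn by (simp add: block_def)
          then have "finprod G e (block k) \<in> K t"
            using e_other by (intro finprod_in_subgroup[OF K_subgroup]) (auto simp: block_def)
          moreover have "listing k \<in> K t" using listing_in_K[of k n t] that tn by simp
          ultimately show ?thesis
            unfolding twisted_def using subgroup.m_closed[OF K_subgroup] by blast
        qed
        have "x r \<in> K t" if r: "r \<noteq> 2 * n + 1" for r
        proof (cases "even r")
          case True
          then obtain s where "r = 2 * s" by blast
          then show ?thesis
            using even_in[of s t] xt subgroup.one_closed[OF K_subgroup] by (cases "s = t") auto
        next
          case False
          then obtain k where k: "r = 2 * k + 1" by (rule oddE)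
          obtain c :: int where "x r = twisted k [^] c"
            using x_piece[of r] k by (auto simp: generator_def)
          then have "k < n \<Longrightarrow> x r \<in> K t"
            using subgroup_int_pow_closed[OF K_subgroup below] by simp
          moreover have "n < k \<Longrightarrow> x r \<in> K t"
            using after k subgroup.one_closed[OF K_subgroup] by simp
          ultimately show ?thesis using r k by (cases "k < n") auto
        qed
        moreover have "y \<in> K t"
        proof -
          have "start i \<le> start n"
            using \<open>n \<ge> i\<close> start_after_block[of i n] by (cases "i = n") auto
          then show ?thesis using y_in tn by simp
        qed
        ultimately have v_in: "x (2 * n + 1) \<in> K t"
          using exceptional_factor_in_subgroup[OF K_subgroup x(2)] x(1) by blast
        obtain c :: int where c: "x (2 * n + 1) = twisted n [^] c"
          using x_piece[of "2 * n + 1"] by (auto simp: generator_def)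
        let ?w = "listing n \<otimes> finprod G e (block n - {t})"
        have rest: "finprod G e (block n - {t}) \<in> K t"
          using e_other by (intro finprod_in_subgroup[OF K_subgroup]) (auto simp: block_def)
        then have w: "?w \<in> K t"
          using listing_in_K[of n n t] tn subgroup.m_closed[OF K_subgroup] by blast
        have cl: "finprod G e (block n - {t}) \<in> carrier G" "?w \<in> carrier G"
          using rest w subgroup.subset[OF K_subgroup] by blast+
        have "insert t (block n - {t}) = block n" using t by blast
        moreover have "finprod G e (insert t (block n - {t})) = e t \<otimes> finprod G e (block n - {t})"
          by (rule finprod_insert) (auto simp: block_def e_closed)
        ultimately have "twisted n = e t \<otimes> ?w"
          unfolding twisted_def using cl listing_closed e_closed by (simp add: m_lcomm)
        then have "x (2 * n + 1) = e t [^] c \<otimes> ?w [^] c"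
          using c cl e_closed by (simp add: int_pow_distrib)
        then have "e t [^] c \<in> K t"
          using subgroup_mult_cancel[OF K_subgroup] v_in e_closed
            subgroup_int_pow_closed[OF K_subgroup w] by simp
        then have "twisted n [^] c = \<one>" using e_power twisted_closed by blast
        then show False using n c by simp
      qed
      then have "(\<lambda>t. 2 * t) ` block n \<subseteq> {r. r < 2 * (start n + n + 1) \<and> x r \<noteq> \<one>}"
        by (auto simp: block_def)
      then have "card ((\<lambda>t. 2 * t) ` block n) \<le> card {r. r < 2 * (start n + n + 1) \<and> x r \<noteq> \<one>}"
        by (intro card_mono) auto
      moreover have "card ((\<lambda>t. 2 * t) ` block n) = n + 1"
        by (subst card_image) (auto simp: block_def inj_on_def)
      moreover have "\<phi> (2 * (start n + n + 1)) \<le> n"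
        using slow_le[of n] by (simp add: \<phi>_def)
      ultimately show False using few[of "2 * (start n + n + 1)"] by linarith
    next
      case False
      have "\<exists>r. x r \<noteq> \<one>"
      proof (rule ccontr)
        assume "\<not> (\<exists>r. x r \<noteq> \<one>)"
        then have "total x \<in> {\<one>}" by (intro total_in_subgroup[OF triv_subgroup]) simp
        then show False using x(1) y(2) by simp
      qed
      then obtain r where r: "x r \<noteq> \<one>" ..
      then have "even r" using False by (metis oddE)
      then obtain t where t: "r = 2 * t" by blast
      have "x k \<in> K t" if "k \<noteq> r" for k
      proof (cases "even k")
        case True
        then show ?thesis using even_in that t by (metis evenE)
      next
        case False
        then obtain j where "k = 2 * j + 1" by (rule oddE)
        then show ?thesis
          using \<open>\<not> (\<exists>n. x (2 * n + 1) \<noteq> \<one>)\<close> subgroup.one_closed[OF K_subgroup] by simp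
      qed
      moreover have "y \<in> K t" using y_in late[OF r] t by simp
      ultimately have "x r \<in> K t"
        using exceptional_factor_in_subgroup[OF K_subgroup x(2)] x(1) by blast
      moreover obtain c :: int where "x r = e t [^] c"
        using x_piece[of r] t by (auto simp: generator_def)
      ultimately show False using e_power e_closed r by metis
    qed
  qed
  ultimately show ?thesis unfolding sparse_base_def by blast
qed

theorem complete_minimally_almost_periodic:
  "\<exists>T. group_topology G T \<and> Hausdorff_space T \<and> minimally_almost_periodic G T \<and>
     complete_group_topology G T"
proof (intro exI conjI)
  show "group_topology G base_topology" by (rule group_topology_base)
  show "Hausdorff_space base_topology" using Hausdorff_base separated by blast
  show "complete_group_topology G base_topology" using complete_sparse boundedly_sparse by blast
  have "(\<lambda>x. 1) \<in> continuous_characters G base_topology"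
    by (auto simp: continuous_characters_def circle_group_def hom_def)
  then show "minimally_almost_periodic G base_topology"
    unfolding minimally_almost_periodic_def von_Neumann_radical_def
    using character_trivial by (auto simp: kernel_def circle_group_def)
qed

end

section \<open>Coordinates of a direct sum of cyclic groups\<close>

text \<open>Coordinates with respect to a decomposition into finite cyclic groups; \<open>h x a\<close> is the residue modulo \<open>q a\<close>
  that represents the coordinate of \<open>x\<close> at \<open>a\<close>.\<close>

locale cyclic_sum_iso = comm_group G for G (structure) +
  fixes I :: "'i set" and q :: "'i \<Rightarrow> nat" and h :: "'a \<Rightarrow> 'i \<Rightarrow> int"
  assumes q_pos: "a \<in> I \<Longrightarrow> 0 < q a"
    and h_iso: "h \<in> iso G (sum_group I (\<lambda>a. integer_mod_group (q a)))"
begin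

lemma carrier_cyclic_sum:
  "carrier (sum_group I (\<lambda>a. integer_mod_group (q a))) =
     {x \<in> \<Pi>\<^sub>E a\<in>I. {0..<int (q a)}. finite {a \<in> I. x a \<noteq> 0}}"
  using q_pos by (auto simp: carrier_sum_group carrier_integer_mod_group PiE_iff)

lemma h_closed:
  assumes "x \<in> carrier G"
  shows "h x \<in> (\<Pi>\<^sub>E a\<in>I. {0..<int (q a)})" "finite {a \<in> I. h x a \<noteq> 0}"
proof -
  have "h x \<in> carrier (sum_group I (\<lambda>a. integer_mod_group (q a)))"
    using h_iso assms by (auto simp: iso_def hom_def)
  then show "h x \<in> (\<Pi>\<^sub>E a\<in>I. {0..<int (q a)})" "finite {a \<in> I. h x a \<noteq> 0}"
    unfolding carrier_cyclic_sum by blast+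
qed

lemma h_range: "x \<in> carrier G \<Longrightarrow> a \<in> I \<Longrightarrow> h x a \<in> {0..<int (q a)}"
  using h_closed(1) by (rule PiE_mem)

lemma h_mult:
  assumes "x \<in> carrier G" "y \<in> carrier G" "a \<in> I"
  shows "h (x \<otimes> y) a = (h x a + h y a) mod int (q a)"
proof -
  have "h (x \<otimes> y) = h x \<otimes>\<^bsub>sum_group I (\<lambda>a. integer_mod_group (q a))\<^esub> h y"
    using h_iso assms by (simp add: iso_def hom_def)
  then show ?thesis using assms(3) by simp
qed

lemma h_one: assumes "a \<in> I" shows "h \<one> a = 0"
proof -
  have "h \<one> a = (h \<one> a + h \<one> a) mod int (q a)" using h_mult[of \<one> \<one> a] assms by simp
  moreover have "h \<one> a mod int (q a) = h \<one> a"
    using h_range[OF one_closed assms] by simp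
  ultimately have "(h \<one> a + h \<one> a) mod int (q a) = (h \<one> a + 0) mod int (q a)" by simp
  then have "h \<one> a mod int (q a) = 0"
    by (metis add_diff_cancel_left' diff_zero mod_0 mod_eq_dvd_iff mod_eq_0_iff_dvd)
  then show ?thesis using \<open>h \<one> a mod int (q a) = h \<one> a\<close> by simp
qed

lemma h_pow:
  assumes "x \<in> carrier G" "a \<in> I"
  shows "h (x [^] (k::nat)) a = (int k * h x a) mod int (q a)"
proof (induction k)
  case 0 then show ?case using h_one assms by simp
next
  case (Suc k)
  have "h (x [^] Suc k) a = (int k * h x a mod int (q a) + h x a) mod int (q a)"
    using h_mult[OF _ assms(1,2), of "x [^] k"] assms Suc by simp
  then show ?case by (simp add: mod_simps algebra_simps)
qed

lemma h_inv:
  assumes "x \<in> carrier G" "a \<in> I"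
  shows "h (inv x) a = (- h x a) mod int (q a)"
proof -
  have "(h (inv x) a + h x a) mod int (q a) = 0"
    using h_mult[of "inv x" x a] h_one assms by simp
  then have "h (inv x) a mod int (q a) = (- h x a) mod int (q a)"
    by (simp add: mod_eq_dvd_iff mod_eq_0_iff_dvd)
  then show ?thesis using h_range[OF inv_closed assms(2)] assms(1) by simp
qed

lemma h_int_pow:
  assumes "x \<in> carrier G" "a \<in> I"
  shows "h (x [^] (k::int)) a = (k * h x a) mod int (q a)"
proof (cases "k \<ge> 0")
  case True
  then obtain n where "k = int n" using nonneg_int_cases by blast
  then show ?thesis using h_pow[OF assms, of n] by (simp add: int_pow_int)
next
  case False
  then obtain n where n: "k = - int n" by (metis int_cases2 of_nat_0_le_iff)
  then have "x [^] k = inv (x [^] n)" using assms(1) by (simp add: int_pow_neg_int)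
  then show ?thesis
    using h_inv[of "x [^] n" a] h_pow[OF assms, of n] assms n by (simp add: mod_minus_eq)
qed

lemma h_eqI:
  assumes "x \<in> carrier G" "y \<in> carrier G" "\<And>a. a \<in> I \<Longrightarrow> h x a = h y a"
  shows "x = y"
proof -
  have "h x = h y" using PiE_ext h_closed(1) assms by metis
  then show ?thesis using h_iso assms(1,2) by (auto simp: iso_def bij_betw_def dest: inj_onD)
qed

lemma element_with_coordinates:
  assumes "\<And>a. a \<in> I \<Longrightarrow> f a \<in> {0..<int (q a)}" "finite {a \<in> I. f a \<noteq> 0}"
  obtains x where "x \<in> carrier G" "\<And>a. a \<in> I \<Longrightarrow> h x a = f a"
proof -
  have "{a \<in> I. restrict f I a \<noteq> 0} = {a \<in> I. f a \<noteq> 0}" by auto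
  then have "restrict f I \<in> carrier (sum_group I (\<lambda>a. integer_mod_group (q a)))"
    unfolding carrier_cyclic_sum using assms by simp
  moreover have "h ` carrier G = carrier (sum_group I (\<lambda>a. integer_mod_group (q a)))"
    using h_iso by (simp add: iso_def bij_betw_def)
  ultimately obtain x where "x \<in> carrier G" "h x = restrict f I" by (metis imageE)
  then show ?thesis using that by simp
qed

end

lemma cis_mod_multiple:
  fixes z :: int and p n :: nat
  assumes "p > 0" "n \<ge> 1"
  shows "cis (2 * pi * real_of_int (z mod int (p ^ n)) / real p) = cis (2 * pi * real_of_int z / real p)"
proof -
  obtain n' where n: "n = Suc n'" using assms(2) by (cases n) auto
  define d where "d = int (p ^ n') * (z div int (p ^ n))"
  have "z = z mod int (p ^ n) + int p * d"
    unfolding d_def n by (simp add: mult.assoc[symmetric])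
  then have "real_of_int z = real_of_int (z mod int (p ^ n)) + real p * real_of_int d"
    by (metis of_int_add of_int_mult of_int_of_nat_eq)
  then have "2 * pi * real_of_int z / real p =
      2 * pi * real_of_int (z mod int (p ^ n)) / real p + 2 * pi * real_of_int d"
    using assms(1) by (simp add: field_simps)
  then have "cis (2 * pi * real_of_int z / real p) =
      cis (2 * pi * real_of_int (z mod int (p ^ n)) / real p) * cis (2 * pi * real_of_int d)"
    by (simp only: cis_mult)
  moreover have "cis (2 * pi * real_of_int d) = 1" by (rule cis_multiple_2pi) simp
  ultimately show ?thesis by simp
qed

locale prime_power_sum = comm_group G for G (structure) +
  fixes M :: "nat set" and n :: "nat \<Rightarrow> nat" and k :: "nat \<Rightarrow> nat \<Rightarrow> 'a set"
    and h :: "'a \<Rightarrow> nat \<times> nat \<times> 'a \<Rightarrow> int"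
  assumes finite_M: "finite M"
    and prime_M: "p \<in> M \<Longrightarrow> Factorial_Ring.prime p"
    and n_pos: "p \<in> M \<Longrightarrow> 1 \<le> n p"
    and leading_nonempty: "p \<in> M \<Longrightarrow> k (n p) p \<noteq> {}"
    and iso: "h \<in> iso G (sum_group {(p, i, j). p \<in> M \<and> i \<in> {1..n p} \<and> j \<in> k i p}
                  (\<lambda>(p, i, j). integer_mod_group (p ^ i)))"
begin

definition I :: "(nat \<times> nat \<times> 'a) set" where
  "I = {(p, i, j). p \<in> M \<and> i \<in> {1..n p} \<and> j \<in> k i p}"

definition modulus :: "nat \<times> nat \<times> 'a \<Rightarrow> nat" where
  "modulus = (\<lambda>(p, i, j). p ^ i)"

sublocale cyclic_sum_iso G I modulus h
proof (intro cyclic_sum_iso.intro cyclic_sum_iso_axioms.intro)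
  show "comm_group G" by (rule comm_group_axioms)
  show "0 < modulus a" if "a \<in> I" for a
    using that prime_M prime_gt_0_nat by (auto simp: I_def modulus_def)
  have "(\<lambda>(p, i, j). integer_mod_group (p ^ i)) = (\<lambda>a. integer_mod_group (modulus a))"
    by (auto simp: modulus_def)
  then show "h \<in> iso G (sum_group I (\<lambda>a. integer_mod_group (modulus a)))"
    using iso by (simp add: I_def)
qed

definition exponent :: nat where
  "exponent = (\<Prod>p\<in>M. p ^ n p)"

lemma exponent_pos: "exponent > 0"
  unfolding exponent_def using prime_M prime_gt_0_nat by (simp add: prod_pos)

lemma top_power_dvd_exponent: "p \<in> M \<Longrightarrow> p ^ n p dvd exponent"
  unfolding exponent_def using finite_M by (rule dvd_prodI)

lemma modulus_dvd:
  assumes "a \<in> I" "\<And>p. p \<in> M \<Longrightarrow> int (p ^ n p) dvd c"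
  shows "int (modulus a) dvd c"
proof -
  obtain p i j where a: "a = (p, i, j)" "p \<in> M" "i \<le> n p" using assms(1) by (auto simp: I_def)
  then have "p ^ i dvd p ^ n p" by (simp add: le_imp_power_dvd)
  then have "int (p ^ i) dvd int (p ^ n p)" by (simp only: of_nat_dvd_iff)
  then have "int (p ^ i) dvd c" using assms(2)[OF a(2)] by (rule dvd_trans)
  then show ?thesis by (simp add: a(1) modulus_def)
qed

lemma pow_eq_one:
  assumes "x \<in> carrier G" "\<And>p. p \<in> M \<Longrightarrow> int (p ^ n p) dvd c"
  shows "x [^] (c::int) = \<one>"
proof (rule h_eqI)
  show "h (x [^] c) a = h \<one> a" if "a \<in> I" for a
    using h_int_pow[OF assms(1) that] h_one[OF that] modulus_dvd[OF that assms(2)] by simp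
qed (use assms in auto)

lemma leading_index:
  assumes "p \<in> M" "j \<in> k (n p) p" shows "(p, n p, j) \<in> I"
  using assms n_pos by (auto simp: I_def)

lemma one_less_top: "p \<in> M \<Longrightarrow> 1 < p ^ n p"
  using prime_M n_pos prime_gt_1_nat by (metis one_less_power less_le_trans zero_less_one)

text \<open>The element \<open>e t\<close> has coordinate 1 at one leading summand for each prime, a different one for each
  \<open>t\<close>. Treating all primes at once makes its order the exponent of \<open>G\<close>, as the last assumption of
  \<open>independent_sequence\<close> demands.\<close>

lemma complete_topology_if_infinite_leading:
  assumes count: "countable (carrier G)"
    and inf: "\<And>p. p \<in> M \<Longrightarrow> infinite (k (n p) p)"
  shows "\<exists>T. group_topology G T \<and> Hausdorff_space T \<and> minimally_almost_periodic G T \<and>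
     complete_group_topology G T"
proof -
  have "\<forall>p\<in>M. \<exists>J::nat \<Rightarrow> 'a. inj J \<and> range J \<subseteq> k (n p) p"
    using inf infinite_countable_subset by blast
  then obtain J :: "nat \<Rightarrow> nat \<Rightarrow> 'a"
    where J: "\<And>p. p \<in> M \<Longrightarrow> inj (J p)" "\<And>p t. p \<in> M \<Longrightarrow> J p t \<in> k (n p) p"
    by (metis rangeI subsetD)
  have idx: "(p, n p, J p t) \<in> I" if "p \<in> M" for p t
    using leading_index J(2) that by blast
  have "\<exists>x\<in>carrier G. \<forall>a\<in>I. h x a = (if \<exists>p\<in>M. a = (p, n p, J p t) then 1 else 0)" for t
  proof -
    let ?f = "\<lambda>a. if \<exists>p\<in>M. a = (p, n p, J p t) then 1 else (0::int)"
    have "?f a \<in> {0..<int (modulus a)}" if "a \<in> I" for a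
      using one_less_top q_pos[OF that] by (auto simp: modulus_def)
    moreover have "{a \<in> I. ?f a \<noteq> 0} \<subseteq> (\<lambda>p. (p, n p, J p t)) ` M" by auto
    then have "finite {a \<in> I. ?f a \<noteq> 0}" using finite_M finite_subset by blast
    ultimately obtain x where "x \<in> carrier G" "\<And>a. a \<in> I \<Longrightarrow> h x a = ?f a"
      using element_with_coordinates[of ?f] by blast
    then show ?thesis by blast
  qed
  then have "\<forall>t. \<exists>x. x \<in> carrier G \<and>
      (\<forall>a\<in>I. h x a = (if \<exists>p\<in>M. a = (p, n p, J p t) then 1 else 0))" by blast
  from choice[OF this] obtain e where e: "\<And>t. e t \<in> carrier G"
    "\<And>t a. a \<in> I \<Longrightarrow> h (e t) a = (if \<exists>p\<in>M. a = (p, n p, J p t) then 1 else 0)"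
    by blast
  define K where "K t = {x \<in> carrier G. \<forall>p\<in>M. h x (p, n p, J p t) = 0}" for t
  interpret independent_sequence G exponent e K
  proof (intro independent_sequence.intro independent_sequence_axioms.intro)
    show "comm_group G" by (rule comm_group_axioms)
    show "countable (carrier G)" by (rule count)
    show "exponent > 0" by (rule exponent_pos)
    show "e t \<in> carrier G" for t by (rule e)
    show "x [^] exponent = \<one>" if "x \<in> carrier G" for x
    proof -
      have "x [^] int exponent = \<one>"
        by (rule pow_eq_one[OF that]) (simp only: of_nat_dvd_iff top_power_dvd_exponent)
      then show ?thesis by (simp add: int_pow_int)
    qed
    show "subgroup (K t) G" for t
    proof
      show "K t \<subseteq> carrier G" by (auto simp: K_def)
      show "\<one> \<in> K t" using h_one idx by (simp add: K_def)
      show "x \<otimes> y \<in> K t" if "x \<in> K t" "y \<in> K t" for x y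
        using that h_mult idx by (simp add: K_def)
      show "inv x \<in> K t" if "x \<in> K t" for x
        using that h_inv idx by (simp add: K_def)
    qed
    show "e i \<in> K t" if "i \<noteq> t" for i t
    proof -
      have "h (e i) (p, n p, J p t) = 0" if p: "p \<in> M" for p
        using e(2)[OF idx[OF p]] injD[OF J(1)[OF p], of t i] \<open>i \<noteq> t\<close> by auto
      then show ?thesis using e(1) by (simp add: K_def)
    qed
    show "finite {t. x \<notin> K t}" if x: "x \<in> carrier G" for x
    proof -
      have "finite ((\<lambda>t. (p, n p, J p t)) -` {a \<in> I. h x a \<noteq> 0})" if "p \<in> M" for p
        using h_closed(2)[OF x] J(1)[OF that] by (intro finite_vimageI) (auto simp: inj_on_def)
      then have "finite (\<Union>p\<in>M. (\<lambda>t. (p, n p, J p t)) -` {a \<in> I. h x a \<noteq> 0})"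
        using finite_M by blast
      moreover have "{t. x \<notin> K t} \<subseteq> (\<Union>p\<in>M. (\<lambda>t. (p, n p, J p t)) -` {a \<in> I. h x a \<noteq> 0})"
        using x idx by (auto simp: K_def)
      ultimately show ?thesis using finite_subset by blast
    qed
    show "x [^] c = \<one>" if "e t [^] c \<in> K t" "x \<in> carrier G" for t x and c :: int
    proof (rule pow_eq_one[OF that(2)])
      fix p assume p: "p \<in> M"
      have "h (e t [^] c) (p, n p, J p t) = c mod int (p ^ n p)"
        using h_int_pow[OF e(1) idx[OF p]] e(2)[OF idx[OF p]] p by (auto simp: modulus_def)
      then show "int (p ^ n p) dvd c" using that(1) p by (simp add: K_def mod_eq_0_iff_dvd)
    qed
  qed
  show ?thesis by (rule complete_minimally_almost_periodic)
qed

text \<open>The exponent of \<open>G\<close> divided by \<open>p\<close> is the number \<open>c\<close> below. Raising to the power \<open>c\<close> leaves only the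
  finitely many leading coordinates at \<open>p\<close>, so its range \<open>R\<close> is finite and its kernel is open in a
  Hausdorff topology. The character \<open>\<gamma>\<close> is constant on the cosets of this kernel.\<close>

lemma not_MinAP_if_finite_leading:
  assumes T: "group_topology G T" "Hausdorff_space T" and p: "p \<in> M" and fin: "finite (k (n p) p)"
  shows "\<not> minimally_almost_periodic G T"
proof
  assume map: "minimally_almost_periodic G T"
  have top: "topspace T = carrier G"
    and cm: "continuous_map (prod_topology T T) T (\<lambda>(x, y). x \<otimes> y)"
    using T(1) by (auto simp: group_topology_def)
  have cont_mult: "continuous_map T T (\<lambda>x. f x \<otimes> g x)"
    if "continuous_map T T f" "continuous_map T T g" for f g
  proof -
    have "continuous_map T (prod_topology T T) (\<lambda>x. (f x, g x))"
      using that by (simp add: continuous_map_pairedI)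
    from continuous_map_compose[OF this cm] show ?thesis by (simp add: o_def)
  qed
  have cont_pow: "continuous_map T T (\<lambda>x. x [^] (c::nat))" for c
  proof (induction c)
    case 0 then show ?case by (simp add: top)
  next
    case (Suc c)
    from cont_mult[OF this continuous_map_id[unfolded id_def]] show ?case by simp
  qed
  obtain j0 where j0: "j0 \<in> k (n p) p" using leading_nonempty[OF p] by blast
  let ?a0 = "(p, n p, j0)"
  have a0: "?a0 \<in> I" by (rule leading_index[OF p j0])
  have pp: "Factorial_Ring.prime p" "p > 1" using prime_M[OF p] prime_gt_1_nat by auto
  define u where "u = (\<Prod>r\<in>M - {p}. r ^ n r)"
  define c where "c = u * p ^ (n p - 1)"
  define L where "L = {(p, n p, j) | j. j \<in> k (n p) p}"
  have finL: "finite L" unfolding L_def using fin by simp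
  \<comment> \<open>All other coordinates of a \<open>c\<close>-th power vanish.\<close>
  have uncover: "int (modulus a) dvd int c" if a: "a \<in> I" "a \<notin> L" for a
  proof -
    obtain r i j where r: "a = (r, i, j)" "r \<in> M" "i \<le> n r" "j \<in> k i r"
      using a(1) by (auto simp: I_def)
    have "r ^ i dvd c"
    proof (cases "r = p")
      case True
      then have "i \<noteq> n p" using a(2) r by (auto simp: L_def)
      then have "i \<le> n p - 1" using r(3) unfolding True by simp
      then have "r ^ i dvd p ^ (n p - 1)" using True by (simp add: le_imp_power_dvd)
      then show ?thesis by (simp add: c_def)
    next
      case False
      then have "r ^ n r dvd u" unfolding u_def using finite_M r by (intro dvd_prodI) auto
      then show ?thesis using r(3) unfolding c_def by (meson dvd_mult2 dvd_trans le_imp_power_dvd)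
    qed
    then show ?thesis using r(1) by (simp add: modulus_def flip: of_nat_power)
  qed
  define R where "R = (\<lambda>x. x [^] c) ` carrier G"
  have "finite R"
  proof (rule inj_on_finite)
    show "inj_on (\<lambda>y. restrict (h y) (I \<inter> L)) R"
    proof (rule inj_onI)
      fix y z assume yz: "y \<in> R" "z \<in> R" "restrict (h y) (I \<inter> L) = restrict (h z) (I \<inter> L)"
      show "y = z"
      proof (rule h_eqI)
        fix a assume a: "a \<in> I"
        show "h y a = h z a"
        proof (cases "a \<in> L")
          case True then show ?thesis using a yz(3) by (metis IntI restrict_apply')
        next
          case False
          then have "h w a = 0" if "w \<in> R" for w
            using that uncover[OF a] h_pow[OF _ a, of _ c] unfolding R_def by auto
          then show ?thesis using yz by simp
        qed
      qed (use yz in \<open>auto simp: R_def\<close>)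
    qed
    show "(\<lambda>y. restrict (h y) (I \<inter> L)) ` R \<subseteq> (\<Pi>\<^sub>E a\<in>I \<inter> L. {0..<int (modulus a)})"
    proof (rule image_subsetI)
      fix y assume "y \<in> R"
      then have "y \<in> carrier G" by (auto simp: R_def)
      then show "restrict (h y) (I \<inter> L) \<in> (\<Pi>\<^sub>E a\<in>I \<inter> L. {0..<int (modulus a)})"
        using h_range by (simp add: PiE_iff del: atLeastLessThan_iff)
    qed
    show "finite (\<Pi>\<^sub>E a\<in>I \<inter> L. {0..<int (modulus a)})" using finL by (intro finite_PiE) auto
  qed
  then have "closedin T (R - {\<one>})"
    using Hausdorff_imp_t1_space[OF T(2)] top by (auto simp: t1_space_closedin_finite R_def)
  then have "openin T (topspace T - (R - {\<one>}))"
    by (rule openin_diff[OF openin_topspace])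
  then have "openin T {x \<in> topspace T. x [^] c \<in> topspace T - (R - {\<one>})}"
    by (rule openin_continuous_map_preimage[OF cont_pow])
  moreover have "{x \<in> topspace T. x [^] c \<in> topspace T - (R - {\<one>})} = {x \<in> carrier G. x [^] c = \<one>}"
    by (auto simp: top R_def)
  ultimately have open_ker: "openin T {x \<in> carrier G. x [^] c = \<one>}" by simp
  define \<gamma> where "\<gamma> x = cis (2 * pi * real_of_int (h x ?a0) / real p)" for x
  have hom: "\<gamma> (x \<otimes> y) = \<gamma> x * \<gamma> y" if "x \<in> carrier G" "y \<in> carrier G" for x y
  proof -
    have "\<gamma> (x \<otimes> y) = cis (2 * pi * real_of_int (h x ?a0 + h y ?a0) / real p)"
      unfolding \<gamma>_def h_mult[OF that a0] using cis_mod_multiple[of p "n p"] pp n_pos[OF p]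
      by (simp add: modulus_def)
    also have "2 * pi * real_of_int (h x ?a0 + h y ?a0) / real p =
        2 * pi * real_of_int (h x ?a0) / real p + 2 * pi * real_of_int (h y ?a0) / real p"
      by (simp add: add_divide_distrib algebra_simps)
    finally show ?thesis by (simp add: \<gamma>_def cis_mult)
  qed
  \<comment> \<open>If \<open>x^c = 1\<close>, then \<open>p\<close> divides the coordinate of \<open>x\<close>, since \<open>c\<close> has exactly \<open>n p - 1\<close> factors \<open>p\<close>.\<close>
  have triv: "\<gamma> x = 1" if x: "x \<in> carrier G" "x [^] c = \<one>" for x
  proof -
    have "int c * h x ?a0 mod int (p ^ n p) = 0"
      using h_pow[OF x(1) a0, of c] x(2) h_one[OF a0] by (simp add: modulus_def)
    then have "int (p ^ n p) dvd int c * h x ?a0" by (simp add: mod_eq_0_iff_dvd)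
    moreover have "int (p ^ n p) = int p ^ (n p - 1) * int p"
      using n_pos[OF p] by (cases "n p") auto
    moreover have "int c * h x ?a0 = int p ^ (n p - 1) * (int u * h x ?a0)" by (simp add: c_def)
    ultimately have "int p dvd int u * h x ?a0" using pp by simp
    moreover have "\<not> p dvd u"
    proof
      assume "p dvd u"
      then obtain r where r: "r \<in> M - {p}" "p dvd r ^ n r"
        unfolding u_def using pp(1) finite_M by (subst (asm) prime_dvd_prod_iff) auto
      then have "p dvd r" using pp(1) prime_dvd_power by blast
      then have "p = r" using primes_dvd_imp_eq[OF pp(1)] prime_M r(1) by blast
      then show False using r(1) by blast
    qed
    then have "\<not> int p dvd int u" by simp
    ultimately have "int p dvd h x ?a0"
      using pp(1) prime_dvd_mult_iff[of "int p"] by simp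
    then obtain w where "h x ?a0 = int p * w" by blast
    then have "2 * pi * real_of_int (h x ?a0) / real p = 2 * pi * real_of_int w"
      using pp(2) by simp
    then show ?thesis by (simp add: \<gamma>_def)
  qed
  have "continuous_map T (top_of_set (sphere 0 1)) \<gamma>"
    unfolding continuous_map_def
  proof (intro conjI allI impI)
    show "\<gamma> \<in> topspace T \<rightarrow> topspace (top_of_set (sphere 0 1))" by (simp add: \<gamma>_def)
    fix U :: "complex set"
    let ?S = "{x \<in> topspace T. \<gamma> x \<in> U}"
    have "\<exists>V. openin T V \<and> x \<in> V \<and> V \<subseteq> ?S" if x: "x \<in> ?S" for x
    proof (intro exI conjI)
      have xG: "x \<in> carrier G" using x top by simp
      let ?V = "{y \<in> topspace T. inv x \<otimes> y \<in> {z \<in> carrier G. z [^] c = \<one>}}"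
      have "continuous_map T T (\<lambda>y. inv x \<otimes> y)"
        using cont_mult[of "\<lambda>_. inv x" "\<lambda>y. y"] xG top by simp
      then show "openin T ?V" 
        using open_ker by (rule openin_continuous_map_preimage)
      show "x \<in> ?V" using xG top by simp
      show "?V \<subseteq> ?S"
      proof
        fix y assume y: "y \<in> ?V"
        then have yG: "y \<in> carrier G" and "\<gamma> (inv x \<otimes> y) = 1" using triv top by auto
        then have "\<gamma> (x \<otimes> (inv x \<otimes> y)) = \<gamma> x" using hom xG by simp
        moreover have "x \<otimes> (inv x \<otimes> y) = y" using xG yG by (metis inv_closed m_assoc r_inv l_one)
        ultimately show "y \<in> ?S" using x yG top by simp
      qed
    qed
    then show "openin T ?S" by (subst openin_subopen) blast
  qed
  then have "\<gamma> \<in> continuous_characters G T"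
    using hom by (auto simp: continuous_characters_def circle_group_def hom_def \<gamma>_def)
  then have all: "\<gamma> x = 1" if "x \<in> carrier G" for x
    using that map unfolding minimally_almost_periodic_def von_Neumann_radical_def
    by (auto simp: kernel_def circle_group_def)
  \<comment> \<open>The element whose only nonzero coordinate is 1, at \<open>a0\<close>, is mapped to a primitive \<open>p\<close>-th root of unity.\<close>
  have "1 < int p ^ n p"
    using one_less_top[OF p] by (metis of_nat_1 of_nat_less_iff of_nat_power)
  then have "(if a = ?a0 then 1 else 0) \<in> {0..<int (modulus a)}" if "a \<in> I" for a
    using q_pos[OF that] by (auto simp: modulus_def)
  moreover have "finite {a \<in> I. (if a = ?a0 then 1 else 0::int) \<noteq> 0}" by simp
  ultimately obtain x where x: "x \<in> carrier G" "\<And>a. a \<in> I \<Longrightarrow> h x a = (if a = ?a0 then 1 else 0)"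
    using element_with_coordinates[of "\<lambda>a. if a = ?a0 then 1 else 0"] by blast
  have "cis (2 * pi / real p) = 1" using all[OF x(1)] x(2)[OF a0] by (simp add: \<gamma>_def)
  then have "cos (2 * pi / real p) = 1" by (metis cis.simps(1) one_complex.simps(1))
  then obtain i :: int where "2 * pi / real p = real_of_int i * 2 * pi"
    using cos_one_2pi_int by blast
  then have "1 = real_of_int i * real p" using pp(2) by (simp add: field_simps)
  then have "1 = i * int p" by (metis of_int_1 of_int_eq_iff of_int_mult of_int_of_nat_eq)
  then have "int p dvd 1" by (metis dvd_triv_right)
  then show False using pp(2) by simp
qed

end

lemma (in comm_group) prime_power_sum_if_cyclic_decomposition:
  assumes "cyclic_decomposition G M n k"
  shows "\<exists>h. prime_power_sum G M n k h"
proof -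
  obtain h where "h \<in> iso G (sum_group {(p, i, j). p \<in> M \<and> i \<in> {1..n p} \<and> j \<in> k i p}
      (\<lambda>(p, i, j). integer_mod_group (p ^ i)))"
    using assms unfolding cyclic_decomposition_def is_iso_def by blast
  then have "prime_power_sum G M n k h"
    using assms unfolding cyclic_decomposition_def
    by (intro prime_power_sum.intro prime_power_sum_axioms.intro comm_group_axioms) blast+
  then show ?thesis by (intro exI[of _ h])
qed

section \<open>The leading invariants decide\<close>

theorem corollary2:
  fixes G :: "('a, 'm) monoid_scheme"
  assumes "comm_group G"
    and "countable (carrier G)" and "infinite (carrier G)"
    and "bounded_group G"
  shows "((\<exists>T. group_topology G T \<and> Hausdorff_space T \<and> minimally_almost_periodic G T) \<longleftrightarrow>
            (\<forall>p \<kappa>. leading_UK_invariant G p \<kappa> \<longrightarrow> infinite \<kappa>)) \<and>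
         ((\<exists>T. group_topology G T \<and> Hausdorff_space T \<and> minimally_almost_periodic G T) \<longrightarrow>
            (\<exists>T. group_topology G T \<and> Hausdorff_space T \<and> minimally_almost_periodic G T \<and>
                 complete_group_topology G T))"
proof -
  interpret comm_group G by (rule assms(1))
  let ?MinAP = "\<lambda>T. group_topology G T \<and> Hausdorff_space T \<and> minimally_almost_periodic G T"
  have infinite_leading: "infinite \<kappa>"
    if T: "?MinAP T" and \<kappa>: "leading_UK_invariant G p \<kappa>" for T p \<kappa>
  proof
    assume fin: "finite \<kappa>"
    obtain M n k where dec: "cyclic_decomposition G M n k" and p: "p \<in> M" "\<kappa> = k (n p) p"
      using \<kappa> unfolding leading_UK_invariant_def by blast
    obtain h where "prime_power_sum G M n k h"
      using prime_power_sum_if_cyclic_decomposition[OF dec] by blast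
    then interpret prime_power_sum G M n k h .
    show False using not_MinAP_if_finite_leading[of T p] T p fin by blast
  qed
  have complete: "\<exists>T. group_topology G T \<and> Hausdorff_space T \<and> minimally_almost_periodic G T \<and>
      complete_group_topology G T"
    if inf: "\<forall>p \<kappa>. leading_UK_invariant G p \<kappa> \<longrightarrow> infinite \<kappa>"
  proof -
    obtain M n k where dec: "cyclic_decomposition G M n k"
      using cyclic_decomposition_exists[OF pow_group_exponent(2,1)] assms(4) by blast
    then have "infinite (k (n p) p)" if "p \<in> M" for p
      using inf that unfolding leading_UK_invariant_def by blast
    moreover obtain h where "prime_power_sum G M n k h"
      using prime_power_sum_if_cyclic_decomposition[OF dec] by blast
    then interpret prime_power_sum G M n k h .
    show ?thesis using complete_topology_if_infinite_leading[OF assms(2)] calculation by blast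
  qed
  show ?thesis using infinite_leading complete by blast
qed

end
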